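(* Let $S$ be a simply connected surface with complex coordinate $z=x+iy$, let $\phi\colon S\to\mathbb{R}$ be a positive smooth function and $\mu\colon S\to\mathbb{C}$ a (smooth) complex function satisfying $$2\,\partial\bar\partial\phi=-\sinh 2\phi+|\mu|^2\operatorname{csch}2\phi,\qquad \bar\partial\mu=-2\bar\mu\,\partial\phi\,\operatorname{csch}2\phi .$$ Then there exists a non-conformal harmonic map $f\colon S\to S^3$ such that, with $f_1=\partial f$, $\bar f_1=\bar\partial f$ and $N$ the unit normal of $f$, the complex-bilinear inner products of the frame $\{f,f_1,\bar f_1,N\}$ are the entries of $$A=\begin{pmatrix}1&0&0&0\\0&-1&\cosh2\phi&0\\0&\cosh2\phi&-1&0\\0&0&0&1\end{pmatrix}$$ and $\langle\partial f_1,N\rangle=\mu$. Furthermore such a map $f$ is unique up to isometries of $S^3$: if $g\colon S\to S^3$ is another non-conformal harmonic map such that, with $g_1=\partial g$, $\bar g_1=\bar\partial g$ and $N_g$ the unit normal of $g$, the complex-bilinear inner products of the frame $\{g,g_1,\bar g_1,N_g\}$ are the entries of the matrix $A$ and $\langle\partial g_1,N_g\rangle=\mu$, then $g=R\circ f$ for some $R\in O(4)$.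
   Context: $\partial=\partial/\partial z$, $\bar\partial=\partial/\partial\bar z$; $\langle\,,\rangle$ is the Euclidean inner product of $\mathbb{R}^4\supset S^3$ extended complex-bilinearly to $\mathbb{C}^4$. A smooth map $f\colon S\to S^3\subset\mathbb{R}^4$ is harmonic if $\partial\bar\partial f=-|\partial f|^2f$ with $|\partial f|^2=\langle\partial f,\bar\partial f\rangle$, and non-conformal if $\langle\partial f,\partial f\rangle\neq0$. The unit normal $N$ of $f$ (at points where $f_x,f_y$ are linearly independent) is the real unit vector field orthogonal to $f,f_x,f_y$ such that $\{f,f_x,f_y,N\}$ is a positively oriented frame of $\mathbb{R}^4$. Surfaces are connected. *)

theory Defs
  imports "HOL-Analysis.Analysis"
begin

section \<open>Surfaces with a global complex coordinate\<close>

text \<open>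
  A surface with complex coordinate is a space \<open>S\<close> together with a homeomorphism \<open>z\<close> from \<open>S\<close>
  onto an open subset of the complex plane.  The smooth structure is the one for which \<open>z\<close> is
  a chart, so all derivatives are those of the coordinate representation on \<open>z ` S\<close>.
\<close>

definition complex_coordinate :: "'a::topological_space set \<Rightarrow> ('a \<Rightarrow> complex) \<Rightarrow> bool" where
  "complex_coordinate S z \<longleftrightarrow> open (z ` S) \<and> homeomorphism S (z ` S) z (inv_into S z)"

definition coord_rep :: "'a set \<Rightarrow> ('a \<Rightarrow> complex) \<Rightarrow> ('a \<Rightarrow> 'b) \<Rightarrow> complex \<Rightarrow> 'b" where
  "coord_rep S z F = F \<circ> inv_into S z"

definition pdx :: "(complex \<Rightarrow> 'b::real_normed_vector) \<Rightarrow> complex \<Rightarrow> 'b" where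
  "pdx G w = frechet_derivative G (at w) 1"

definition pdy :: "(complex \<Rightarrow> 'b::real_normed_vector) \<Rightarrow> complex \<Rightarrow> 'b" where
  "pdy G w = frechet_derivative G (at w) \<i>"

text \<open>For open \<open>U\<close>, this is \<open>k\<close>-fold continuous differentiability in the real sense.\<close>

primrec Ck_on :: "nat \<Rightarrow> complex set \<Rightarrow> (complex \<Rightarrow> 'b::real_normed_vector) \<Rightarrow> bool" where
  "Ck_on 0 U G \<longleftrightarrow> continuous_on U G"
| "Ck_on (Suc k) U G \<longleftrightarrow>
     (\<forall>w\<in>U. G differentiable (at w)) \<and> Ck_on k U (pdx G) \<and> Ck_on k U (pdy G)"

definition smooth :: "'a set \<Rightarrow> ('a \<Rightarrow> complex) \<Rightarrow> ('a \<Rightarrow> 'b::real_normed_vector) \<Rightarrow> bool" where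
  "smooth S z F \<longleftrightarrow> (\<forall>k. Ck_on k (z ` S) (coord_rep S z F))"

definition Dx :: "'a set \<Rightarrow> ('a \<Rightarrow> complex) \<Rightarrow> ('a \<Rightarrow> 'b::real_normed_vector) \<Rightarrow> 'a \<Rightarrow> 'b" where
  "Dx S z F p = pdx (coord_rep S z F) (z p)"

definition Dy :: "'a set \<Rightarrow> ('a \<Rightarrow> complex) \<Rightarrow> ('a \<Rightarrow> 'b::real_normed_vector) \<Rightarrow> 'a \<Rightarrow> 'b" where
  "Dy S z F p = pdy (coord_rep S z F) (z p)"

definition d_z :: "'a set \<Rightarrow> ('a \<Rightarrow> complex) \<Rightarrow> ('a \<Rightarrow> complex) \<Rightarrow> 'a \<Rightarrow> complex" where
  "d_z S z F p = (Dx S z F p - \<i> * Dy S z F p) / 2"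

definition d_zbar :: "'a set \<Rightarrow> ('a \<Rightarrow> complex) \<Rightarrow> ('a \<Rightarrow> complex) \<Rightarrow> 'a \<Rightarrow> complex" where
  "d_zbar S z F p = (Dx S z F p + \<i> * Dy S z F p) / 2"

definition d_z_vec ::
  "'a set \<Rightarrow> ('a \<Rightarrow> complex) \<Rightarrow> ('a \<Rightarrow> complex ^ 'n) \<Rightarrow> 'a \<Rightarrow> complex ^ 'n::finite" where
  "d_z_vec S z F p = (\<chi> i. d_z S z (\<lambda>q. F q $ i) p)"

definition d_zbar_vec ::
  "'a set \<Rightarrow> ('a \<Rightarrow> complex) \<Rightarrow> ('a \<Rightarrow> complex ^ 'n) \<Rightarrow> 'a \<Rightarrow> complex ^ 'n::finite" where
  "d_zbar_vec S z F p = (\<chi> i. d_zbar S z (\<lambda>q. F q $ i) p)"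


section \<open>Maps into the three-sphere\<close>

text \<open>
  The complex-bilinear extension of the Euclidean inner product is \<open>scalar_product\<close> on
  \<open>complex ^ 4\<close>; the operation \<open>\<bullet>\<close> there would be the real part of the Hermitian product.
\<close>

definition cvec :: "real ^ 'n \<Rightarrow> complex ^ 'n::finite" where
  "cvec v = (\<chi> i. complex_of_real (v $ i))"

definition del :: "'a set \<Rightarrow> ('a \<Rightarrow> complex) \<Rightarrow> ('a \<Rightarrow> real ^ 4) \<Rightarrow> 'a \<Rightarrow> complex ^ 4" where
  "del S z f = d_z_vec S z (\<lambda>q. cvec (f q))"

definition delbar :: "'a set \<Rightarrow> ('a \<Rightarrow> complex) \<Rightarrow> ('a \<Rightarrow> real ^ 4) \<Rightarrow> 'a \<Rightarrow> complex ^ 4" where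
  "delbar S z f = d_zbar_vec S z (\<lambda>q. cvec (f q))"

definition harmonic_S3 :: "'a set \<Rightarrow> ('a \<Rightarrow> complex) \<Rightarrow> ('a \<Rightarrow> real ^ 4) \<Rightarrow> bool" where
  "harmonic_S3 S z f \<longleftrightarrow>
     smooth S z f \<and> f ` S \<subseteq> sphere 0 1 \<and>
     (\<forall>p\<in>S. d_z_vec S z (delbar S z f) p =
        - scalar_product (del S z f p) (delbar S z f p) *s cvec (f p))"

definition non_conformal :: "'a set \<Rightarrow> ('a \<Rightarrow> complex) \<Rightarrow> ('a \<Rightarrow> real ^ 4) \<Rightarrow> bool" where
  "non_conformal S z f \<longleftrightarrow> (\<forall>p\<in>S. scalar_product (del S z f p) (del S z f p) \<noteq> 0)"

text \<open>
  The sign condition on the determinant expresses that the frame is positively oriented.  It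
  forces \<open>f\<^sub>x\<close> and \<open>f\<^sub>y\<close> to be linearly independent, and together with the other conditions it
  determines \<open>N\<close> on \<open>S\<close>.
\<close>

definition unit_normal ::
  "'a set \<Rightarrow> ('a \<Rightarrow> complex) \<Rightarrow> ('a \<Rightarrow> real ^ 4) \<Rightarrow> ('a \<Rightarrow> real ^ 4) \<Rightarrow> bool" where
  "unit_normal S z f N \<longleftrightarrow>
     (\<forall>p\<in>S. norm (N p) = 1 \<and> N p \<bullet> f p = 0 \<and> N p \<bullet> Dx S z f p = 0 \<and> N p \<bullet> Dy S z f p = 0 \<and>
        det (vector [f p, Dx S z f p, Dy S z f p, N p] :: real ^ 4 ^ 4) > 0)"

definition frame ::
  "'a set \<Rightarrow> ('a \<Rightarrow> complex) \<Rightarrow> ('a \<Rightarrow> real ^ 4) \<Rightarrow> ('a \<Rightarrow> real ^ 4) \<Rightarrow> 'a \<Rightarrow> complex ^ 4 ^ 4" where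
  "frame S z f N p = vector [cvec (f p), del S z f p, delbar S z f p, cvec (N p)]"

definition gram_matrix :: "real \<Rightarrow> complex ^ 4 ^ 4" where
  "gram_matrix t = vector
     [vector [1, 0, 0, 0],
      vector [0, - 1, complex_of_real (cosh (2 * t)), 0],
      vector [0, complex_of_real (cosh (2 * t)), - 1, 0],
      vector [0, 0, 0, 1]]"

text \<open>
  \<open>f\<close> is a non-conformal harmonic map with unit normal \<open>N\<close>, frame inner products given by \<open>\<phi>\<close>,
  and \<open>\<langle>\<partial>\<partial>f, N\<rangle> = \<mu>\<close>.
\<close>

definition harmonic_map_with_data ::
  "'a set \<Rightarrow> ('a \<Rightarrow> complex) \<Rightarrow> ('a \<Rightarrow> real) \<Rightarrow> ('a \<Rightarrow> complex) \<Rightarrow>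
   ('a \<Rightarrow> real ^ 4) \<Rightarrow> ('a \<Rightarrow> real ^ 4) \<Rightarrow> bool" where
  "harmonic_map_with_data S z \<phi> \<mu> f N \<longleftrightarrow>
     harmonic_S3 S z f \<and> non_conformal S z f \<and> unit_normal S z f N \<and>
     (\<forall>p\<in>S. \<forall>i j. scalar_product (frame S z f N p $ i) (frame S z f N p $ j)
                     = gram_matrix (\<phi> p) $ i $ j) \<and>
     (\<forall>p\<in>S. scalar_product (d_z_vec S z (del S z f) p) (cvec (N p)) = \<mu> p)"

definition csch :: "real \<Rightarrow> real" where
  "csch t = 1 / sinh t"

end

theory Submission
  imports Defs "HOL-Complex_Analysis.Riemann_Mapping"
begin

text \<open>
  The inner products prescribed by \<open>A\<close> say that \<open>f\<^sub>x\<close> and \<open>f\<^sub>y\<close> are orthogonal of length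
  \<open>2 sinh \<phi>\<close> and \<open>2 cosh \<phi>\<close>.  So a map \<open>f\<close> with the required data is the same as a map \<open>\<Phi>\<close> into \<open>SO(4)\<close>,
  with rows \<open>f\<close>, \<open>f\<^sub>x / (2 sinh \<phi>)\<close>, \<open>f\<^sub>y / (2 cosh \<phi>)\<close>, \<open>N\<close>, that solves the linear system
  \<open>d\<Phi> = (P dx + Q dy) \<Phi>\<close> for skew matrices \<open>P\<close>, \<open>Q\<close> determined by \<open>\<phi>\<close> and \<open>\<mu>\<close>.  The two equations
  satisfied by \<open>\<phi>\<close> and \<open>\<mu>\<close> (Gauss and Codazzi) express the flatness of this connection, so the system is
  solvable on a simply connected domain, and since \<open>P\<close>, \<open>Q\<close> are skew, \<open>\<Psi>\<^sup>T \<Phi>\<close> is constant for any two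
  solutions; this gives both the orthogonality of \<open>\<Phi>\<close> and the uniqueness up to isometry.
\<close>

section \<open>Linear ordinary differential equations\<close>

text \<open>The difficulty is to solve an overdetermined system on the whole domain and not only
  near a point. Along one segment there is no obstruction, since a solution of a linear equation
  cannot blow up. On a domain that is star-shaped about 0 every point has its own segment from 0, so
  the ansatz is single-valued without any monodromy argument; what remains to be proved is the
  equation in directions transverse to the segments, and this is a statement about dependence on a
  parameter. A biholomorphic change of variable then takes the place of continuation along paths.

  The converse passage, from a map to a frame, meets two gaps in the data. The normal is given by
  pointwise conditions only, so its differentiability must be derived. The symmetry of the mixed
  derivatives of the map is read off from the imaginary part of the harmonic map equation.

  The factors 2 \<open>sinh \<phi>\<close> and 2 \<open>cosh \<phi>\<close> arise because f_x is the
  sum of \<open>del\<close> and \<open>delbar\<close> of f, and f_y is \<i> times their difference: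
  \<open>A\<close> gives the squared lengths 2 cosh 2\<phi> - 2 and 2 cosh 2\<phi> + 2.\<close>

lemma linear_ode_exists:
  fixes p :: "'m::real_normed_vector \<Rightarrow> 'e::banach \<Rightarrow> 'e" and A :: "real \<Rightarrow> 'm"
  assumes p: "bounded_bilinear p" and A: "continuous_on {0..1} A"
  obtains u where "u 0 = u0"
    and "\<And>t. t \<in> {0..1} \<Longrightarrow> (u has_vector_derivative p (A t) (u t)) (at t within {0..1})"
proof -
  interpret p: bounded_bilinear p by (fact p)
  obtain B where B: "B > 0" "\<And>a b. norm (p a b) \<le> norm a * norm b * B"
    using p.pos_bounded by blast
  have "bounded (A ` {0..1})"
    using A compact_continuous_image compact_imp_bounded by blast
  then obtain K where K: "K > 0" "\<And>t. t \<in> {0..1} \<Longrightarrow> norm (A t) \<le> K"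
    by (auto simp: bounded_pos)
  define C where "C = K * B"
  have C0: "C > 0" using K B by (simp add: C_def)
  have C: "norm (p (A t) v) \<le> C * norm v" if "t \<in> {0..1}" for t v
  proof -
    have "norm (p (A t) v) \<le> norm (A t) * norm v * B" by (rule B)
    also have "\<dots> \<le> K * norm v * B"
      using K(2)[OF that] B(1) by (intro mult_right_mono) auto
    finally show ?thesis by (simp add: C_def ac_simps)
  qed
  \<comment> \<open>Picard iteration split into increments: \<open>G n\<close> is the n-fold
    iterated integral of the coefficient applied to \<open>u0\<close>. Integrating over ordered
    times produces the factorial in |u0| (C t)^n / n!, so the series converges on the whole interval
    however large \<open>C\<close> is.\<close>
  define G where "G = rec_nat (\<lambda>t. u0) (\<lambda>_ g t. integral {0..t} (\<lambda>s. p (A s) (g s)))"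
  have G0: "G 0 t = u0" and GS: "G (Suc n) t = integral {0..t} (\<lambda>s. p (A s) (G n s))" for n t
    by (simp_all add: G_def)
  have Gc: "continuous_on {0..1} (G n)" for n
  proof (induction n)
    case (Suc n)
    then have "(\<lambda>s. p (A s) (G n s)) integrable_on {0..1}"
      by (intro integrable_continuous_real p.continuous_on A)
    then show ?case
      using indefinite_integral_continuous_1 by (simp add: GS[abs_def])
  qed (simp add: G_def)
  have pGc: "continuous_on {0..1} (\<lambda>s. p (A s) (G n s))" for n
    by (intro p.continuous_on A Gc)
  have Gd: "(G (Suc n) has_vector_derivative p (A t) (G n t)) (at t within {0..1})"
    if "t \<in> {0..1}" for n t
    using integral_has_vector_derivative[OF pGc that] by (simp add: GS[abs_def])
  have Gb: "norm (G n t) \<le> norm u0 * ((C * t) ^ n / fact n)" if "t \<in> {0..1}" for n t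
    using that
  proof (induction n arbitrary: t)
    case (Suc n)
    let ?\<phi> = "\<lambda>s. norm u0 * ((C * s) ^ Suc n / fact (Suc n))"
    let ?\<phi>' = "\<lambda>s. C * (norm u0 * ((C * s) ^ n / fact n))"
    have "(?\<phi> has_vector_derivative ?\<phi>' s) (at s within {0..t})" for s
    proof -
      have "(?\<phi> has_real_derivative norm u0 * (real (Suc n) * (C * s) ^ n * C / fact (Suc n)))
          (at s within {0..t})"
        by (auto intro!: derivative_eq_intros simp del: power_Suc of_nat_Suc fact_Suc)
      moreover have "norm u0 * (real (Suc n) * (C * s) ^ n * C / fact (Suc n)) = ?\<phi>' s"
        by (simp add: fact_Suc del: of_nat_Suc)
      ultimately show ?thesis
        by (simp only: has_real_derivative_iff_has_vector_derivative)
    qed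
    then have I: "(?\<phi>' has_integral (?\<phi> t - ?\<phi> 0)) {0..t}"
      using Suc.prems by (intro fundamental_theorem_of_calculus) auto
    have "norm (G (Suc n) t) \<le> integral {0..t} ?\<phi>'"
      unfolding GS
    proof (rule integral_norm_bound_integral)
      show "(\<lambda>s. p (A s) (G n s)) integrable_on {0..t}"
        using Suc.prems by (intro integrable_continuous_real continuous_on_subset[OF pGc]) auto
      show "?\<phi>' integrable_on {0..t}" using I by blast
      fix s assume s: "s \<in> {0..t}"
      then have s1: "s \<in> {0..1}" using Suc.prems by auto
      have "norm (p (A s) (G n s)) \<le> C * norm (G n s)" by (rule C[OF s1])
      also have "\<dots> \<le> ?\<phi>' s"
        using Suc.IH[OF s1] C0 by (intro mult_left_mono) auto
      finally show "norm (p (A s) (G n s)) \<le> ?\<phi>' s" .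
    qed
    also have "\<dots> = ?\<phi> t - ?\<phi> 0" using I by (rule integral_unique)
    finally show ?case by simp
  qed (simp add: G_def)
  define M where "M n = norm u0 * (C ^ n / fact n)" for n
  have M: "summable M"
    unfolding M_def using summable_exp[of C]
    by (intro summable_mult) (simp add: divide_inverse mult.commute)
  have GM: "norm (G n t) \<le> M n" if "t \<in> {0..1}" for n t
  proof -
    have "(C * t) ^ n \<le> C ^ n"
      using that C0 by (intro power_mono) (auto simp: mult_le_cancel_left1)
    then show ?thesis
      using Gb[OF that, of n] unfolding M_def
      by (meson divide_right_mono fact_ge_zero mult_left_mono norm_ge_zero order_trans)
  qed
  define g where "g t = (\<Sum>n. G n t)" for t
  have gs: "(\<lambda>n. G n t) sums g t" if "t \<in> {0..1}" for t
    unfolding g_def using summable_comparison_test'[OF M] GM[OF that]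
    by (metis summable_sums)
  have U: "uniform_limit {0..1} (\<lambda>n t. \<Sum>i<n. G i t) g sequentially"
    unfolding g_def by (rule Weierstrass_m_test[OF _ M]) (use GM in auto)
  \<comment> \<open>Derivative of the n-th term. \<open>G 0\<close> is constant, which shifts the
    indices by one: the first n + 1 derivatives add up to \<open>p (A t)\<close> applied to the
    first n terms, whose uniform convergence is already known.\<close>
  define G' where "G' n t = (case n of 0 \<Rightarrow> 0 | Suc m \<Rightarrow> p (A t) (G m t))" for n t
  have G'sum: "(\<Sum>i<Suc n. G' i t) = p (A t) (\<Sum>i<n. G i t)" for n t
    unfolding sum.lessThan_Suc_shift by (simp add: G'_def p.sum_right)
  have "\<exists>u. \<forall>t\<in>{0..1}. (\<lambda>n. G n t) sums u t \<and>
      (u has_derivative (\<lambda>h. h *\<^sub>R p (A t) (g t))) (at t within {0..1})"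
  proof (rule has_derivative_series[where f' = "\<lambda>n t h. h *\<^sub>R G' n t" and x = 0])
    fix n :: nat and t :: real assume "t \<in> {0..1}"
    then show "(G n has_derivative (\<lambda>h. h *\<^sub>R G' n t)) (at t within {0..1})"
      using Gd[of t "n - 1"]
      by (cases n) (simp_all add: G'_def G0[abs_def] has_vector_derivative_def)
  next
    fix e :: real assume e: "e > 0"
    have "\<forall>\<^sub>F n in sequentially. \<forall>t\<in>{0..1}. dist (\<Sum>i<n. G i t) (g t) < e / C"
      using U e C0 by (auto simp: uniform_limit_iff)
    then have "\<forall>\<^sub>F n in sequentially. \<forall>t\<in>{0..1}. \<forall>h.
        norm ((\<Sum>i<Suc n. h *\<^sub>R G' i t) - h *\<^sub>R p (A t) (g t)) \<le> e * norm h"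
    proof eventually_elim
      case (elim n)
      show ?case
      proof (intro ballI allI)
        fix t h :: real assume t: "t \<in> {0..1}"
        have "norm (p (A t) ((\<Sum>i<n. G i t) - g t)) \<le> C * norm ((\<Sum>i<n. G i t) - g t)"
          by (rule C[OF t])
        also have "\<dots> \<le> C * (e / C)"
          using elim t C0 by (intro mult_left_mono) (auto simp: dist_norm less_imp_le)
        finally have "norm ((\<Sum>i<Suc n. G' i t) - p (A t) (g t)) \<le> e"
          using C0 by (simp add: G'sum p.diff_right del: sum.lessThan_Suc)
        then have "norm (h *\<^sub>R ((\<Sum>i<Suc n. G' i t) - p (A t) (g t))) \<le> e * norm h"
          using mult_left_mono[of _ e "\<bar>h\<bar>", OF _ abs_ge_zero]
            by (simp only: norm_scaleR real_norm_def mult.commute[of e])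
        then show "norm ((\<Sum>i<Suc n. h *\<^sub>R G' i t) - h *\<^sub>R p (A t) (g t)) \<le> e * norm h"
          by (simp only: scaleR_sum_right[symmetric] scaleR_diff_right[symmetric])
      qed
    qed
    then show "\<forall>\<^sub>F n in sequentially. \<forall>t\<in>{0..1}. \<forall>h.
        norm ((\<Sum>i<n. h *\<^sub>R G' i t) - h *\<^sub>R p (A t) (g t)) \<le> e * norm h"
      by (simp only: eventually_sequentially_Suc[where P = "\<lambda>n. \<forall>t\<in>{0..1}. \<forall>h.
        norm ((\<Sum>i<n. h *\<^sub>R G' i t) - h *\<^sub>R p (A t) (g t)) \<le> e * norm h"])
  qed (use gs[of 0] in auto)
  then obtain u where u: "\<And>t. t \<in> {0..1} \<Longrightarrow> (\<lambda>n. G n t) sums u t"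
      "\<And>t. t \<in> {0..1} \<Longrightarrow> (u has_derivative (\<lambda>h. h *\<^sub>R p (A t) (g t))) (at t within {0..1})"
    by blast
  have ug: "u t = g t" if "t \<in> {0..1}" for t
    using sums_unique2[OF u(1) gs] that by blast
  have "G n 0 = 0" if "n \<noteq> 0" for n
    using that by (cases n) (simp_all add: GS)
  then have "(\<lambda>n. G n 0) sums (\<Sum>n\<in>{0}. G n 0)"
    by (intro sums_finite) auto
  then have "u 0 = u0"
    using sums_unique2 u(1)[of 0] by (fastforce simp: G0)
  then show ?thesis
    using that[of u] u(2) ug by (simp add: has_vector_derivative_def)
qed

text \<open>The inner product makes the squared norm differentiable also where \<open>u\<close>
  vanishes, in particular at time 0, so the differential inequality is solved for the square. The
  bound is linear in \<open>e\<close>: an error o(k) in the equation remains an error o(k) in the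
  solution.\<close>

lemma gronwall_inner:
  fixes u :: "real \<Rightarrow> 'e::real_inner"
  assumes u: "\<And>t. t \<in> {0..1} \<Longrightarrow> (u has_vector_derivative u' t) (at t within {0..1})"
    and u': "\<And>t. t \<in> {0..1} \<Longrightarrow> norm (u' t) \<le> K * norm (u t) + e"
    and u0: "u 0 = 0" and Ke: "K \<ge> 0" "e \<ge> 0" and t: "t \<in> {0..1}"
  shows "norm (u t) \<le> e * exp (K + 1)"
proof -
  \<comment> \<open>\<open>c\<close> absorbs 2 K |u|^2 and one further |u|^2 from the estimate 2 |u|
    e \<le> |u|^2 + e^2. The remaining e^2 is compensated by the term \<open>e\<^sup>2 * s\<close>
    of \<open>q\<close>, so that \<open>q\<close> does not increase. The final constant uses c \<le>
    2 (K + 1).\<close>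
  define c where "c = 2 * K + 1"
  define q where "q s = (u s \<bullet> u s) * exp (- c * s) - e\<^sup>2 * s" for s
  have qd: "(q has_real_derivative
      2 * (u s \<bullet> u' s) * exp (- c * s) - c * (u s \<bullet> u s) * exp (- c * s) - e\<^sup>2) (at s within {0..1})"
    if "s \<in> {0..1}" for s
  proof -
    have "((\<lambda>s. u s \<bullet> u s) has_real_derivative 2 * (u s \<bullet> u' s)) (at s within {0..1})"
    proof -
      have d: "(u has_derivative (\<lambda>h. h *\<^sub>R u' s)) (at s within {0..1})"
        using u[OF that] by (simp add: has_vector_derivative_def)
      show ?thesis
        unfolding has_field_derivative_def
        by (rule has_derivative_eq_rhs[OF has_derivative_inner[OF d d]])
          (auto simp: inner_commute)
    qed
    then show ?thesis
      unfolding q_def by (auto intro!: derivative_eq_intros)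
  qed
  have le: "2 * (u s \<bullet> u' s) * exp (- c * s) - c * (u s \<bullet> u s) * exp (- c * s) - e\<^sup>2 \<le> 0"
    if "s \<in> {0..1}" for s
  proof -
    have "u s \<bullet> u' s \<le> norm (u s) * norm (u' s)" by (rule norm_cauchy_schwarz)
    also have "\<dots> \<le> norm (u s) * (K * norm (u s) + e)"
      using u'[OF that] by (intro mult_left_mono) auto
    finally have "2 * (u s \<bullet> u' s) \<le> 2 * K * (norm (u s))\<^sup>2 + 2 * norm (u s) * e"
      by (simp add: power2_eq_square algebra_simps)
    also have "2 * norm (u s) * e \<le> (norm (u s))\<^sup>2 + e\<^sup>2"
      using sum_squares_ge_zero[of "norm (u s) - e" 0] by (simp add: power2_eq_square algebra_simps)
    finally have "2 * (u s \<bullet> u' s) - c * (u s \<bullet> u s) \<le> e\<^sup>2"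
      by (simp add: c_def power2_norm_eq_inner algebra_simps)
    then have "(2 * (u s \<bullet> u' s) - c * (u s \<bullet> u s)) * exp (- c * s) \<le> e\<^sup>2 * exp (- c * s)"
      by (intro mult_right_mono) auto
    also have "\<dots> \<le> e\<^sup>2 * 1"
    proof (rule mult_left_mono)
      have "0 \<le> c * s" using that Ke by (simp add: c_def)
      then show "exp (- c * s) \<le> 1" by simp
    qed simp
    finally show ?thesis by (simp add: algebra_simps)
  qed
  have "q t \<le> q 0"
  proof (rule DERIV_nonpos_imp_decreasing_open[where f = q])
    show "continuous_on {0..t} q"
      using t by (intro continuous_on_subset[OF DERIV_continuous_on[OF qd]]) auto
    fix s assume s: "0 < s" "s < t"
    then have s1: "s \<in> {0..1}" and int: "s \<in> interior {0..1}" using t by auto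
    show "\<exists>y. DERIV q s :> y \<and> y \<le> 0"
      using qd[OF s1] le[OF s1] at_within_interior[OF int] by auto
  qed (use t in auto)
  then have "(u t \<bullet> u t) * exp (- c * t) \<le> e\<^sup>2 * t" by (simp add: q_def u0)
  then have "(u t \<bullet> u t) \<le> e\<^sup>2 * t * exp (c * t)"
    by (simp add: exp_minus field_simps)
  also have "\<dots> \<le> e\<^sup>2 * 1 * exp (2 * (K + 1))"
  proof (intro mult_mono)
    have "c * t \<le> c * 1" using t Ke by (intro mult_left_mono) (auto simp: c_def)
    then show "exp (c * t) \<le> exp (2 * (K + 1))" by (simp add: c_def)
  qed (use t in auto)
  also have "\<dots> = (e * exp (K + 1))\<^sup>2"
    unfolding power_mult_distrib exp_double by simp
  finally have "(norm (u t))\<^sup>2 \<le> (e * exp (K + 1))\<^sup>2"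
    by (simp only: power2_norm_eq_inner)
  then show ?thesis
    by (rule power2_le_imp_le) (use Ke in simp)
qed

text \<open>
  Here the solution \<open>V\<close> of the variational equation is given, so that \<open>u (w + k) - u w - V k\<close> solves
  the linear equation up to an error \<open>o(k)\<close> and Gronwall's inequality applies.
\<close>

lemma ode_parameter_derivative:
  fixes p :: "'m::real_normed_vector \<Rightarrow> 'e::real_inner \<Rightarrow> 'e"
    and A :: "'v::real_normed_vector \<Rightarrow> real \<Rightarrow> 'm"
  assumes p: "bounded_bilinear p" and "\<delta> > 0"
    and u: "\<And>v t. dist v w < \<delta> \<Longrightarrow> t \<in> {0..1} \<Longrightarrow>
      (u v has_vector_derivative p (A v t) (u v t)) (at t within {0..1})"
    and u0: "\<And>v. u v 0 = u0"
    and K: "\<And>t. t \<in> {0..1} \<Longrightarrow> norm (A w t) \<le> K"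
    and "L \<ge> 0" and L: "\<And>t k. t \<in> {0..1} \<Longrightarrow> norm (DA t k) \<le> L * norm k"
    and DA: "\<And>e. e > 0 \<Longrightarrow> \<exists>d>0. \<forall>k. norm k < d \<longrightarrow>
      (\<forall>t\<in>{0..1}. norm (A (w + k) t - A w t - DA t k) \<le> e * norm k)"
    and V0: "\<And>k. V k 0 = 0"
    and V: "\<And>k t. t \<in> {0..1} \<Longrightarrow>
      (V k has_vector_derivative p (A w t) (V k t) + p (DA t k) (u w t)) (at t within {0..1})"
    and lin: "bounded_linear (\<lambda>k. V k 1)"
  shows "((\<lambda>v. u v 1) has_derivative (\<lambda>k. V k 1)) (at w)"
proof -
  interpret p: bounded_bilinear p by (fact p)
  obtain B where B: "B > 0" "\<And>a b. norm (p a b) \<le> norm a * norm b * B"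
    using p.pos_bounded by blast
  have pb: "norm (p a b) \<le> B * x * y" if "norm a \<le> x" "norm b \<le> y" for a b x y
  proof -
    have "norm a * norm b * B \<le> x * y * B"
      using that B(1) by (intro mult_right_mono mult_mono) (auto intro: order_trans[OF norm_ge_zero])
    then show ?thesis using B(2)[of a b] by (simp add: ac_simps)
  qed
  have K0: "K \<ge> 0" by (rule order_trans[OF norm_ge_zero K[of 0]]) simp
  have "continuous_on {0..1} (u w)"
    by (rule continuous_on_vector_derivative[OF u]) (use \<open>\<delta> > 0\<close> in auto)
  then have "bounded (u w ` {0..1})"
    using compact_continuous_image compact_imp_bounded by blast
  then obtain M where M: "M > 0" "\<And>t. t \<in> {0..1} \<Longrightarrow> norm (u w t) \<le> M"
    by (auto simp: bounded_pos)
  \<comment> \<open>\<open>L\<close> bounds the linear part of the increment of \<open>A\<close>,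
    and the 1 bounds its remainder, taken with error 1.\<close>
  define L1 where "L1 = L + 1"
  have L1: "L1 > 0" using \<open>L \<ge> 0\<close> by (simp add: L1_def)
  have L1': "norm (DA t k) + norm k \<le> L1 * norm k" if "t \<in> {0..1}" for t k
    using L[OF that, of k] by (simp add: L1_def algebra_simps)
  obtain d1 where d1: "d1 > 0" and DA1: "\<And>k t. norm k < d1 \<Longrightarrow> t \<in> {0..1} \<Longrightarrow>
      norm (A (w + k) t - A w t - DA t k) \<le> 1 * norm k"
    using DA[of 1] by auto
  have DA2: "norm (A (w + k) t - A w t) \<le> L1 * norm k" if "norm k < d1" "t \<in> {0..1}" for k t
    using DA1[OF that] L1'[OF that(2), of k] norm_triangle_ineq[of "A (w + k) t - A w t - DA t k" "DA t k"]
    by simp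
  \<comment> \<open>Lipschitz constant of the solution at \<open>w\<close>, from a first use of
    Gronwall. It makes the product of the increments of \<open>A\<close> and of \<open>u\<close>
    quadratic in \<open>k\<close> in the second use.\<close>
  define C where "C = B * L1 * M * exp (B * (K + L1) + 1)"
  have C0: "C > 0" using B L1 M by (simp add: C_def)
  have du: "norm (u (w + k) t - u w t) \<le> C * norm k"
    if k: "norm k < d1" "norm k < \<delta>" "norm k < 1" and t: "t \<in> {0..1}" for k t
  proof -
    have "norm (u (w + k) t - u w t) \<le> (B * L1 * M * norm k) * exp (B * (K + L1) + 1)"
    proof (rule gronwall_inner[where u = "\<lambda>t. u (w + k) t - u w t", OF _ _ _ _ _ t])
      fix t :: real assume t: "t \<in> {0..1}"
      show "((\<lambda>t. u (w + k) t - u w t) has_vector_derivative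
          (p (A (w + k) t) (u (w + k) t) - p (A w t) (u w t))) (at t within {0..1})"
        using k t \<open>\<delta> > 0\<close> by (intro has_vector_derivative_diff u) (auto simp: dist_norm)
      have eq: "p (A (w + k) t) (u (w + k) t) - p (A w t) (u w t) =
          p (A (w + k) t) (u (w + k) t - u w t) + p (A (w + k) t - A w t) (u w t)"
        by (simp add: p.diff_left p.diff_right)
      have "norm (A (w + k) t) \<le> norm (A w t) + norm (A (w + k) t - A w t)"
        using norm_triangle_ineq[of "A w t" "A (w + k) t - A w t"] by simp
      also have "\<dots> \<le> K + L1 * 1"
        using K[OF t] DA2[OF k(1) t] mult_left_mono[of "norm k" 1 L1] k L1 by linarith
      finally have "norm (A (w + k) t) \<le> K + L1" by simp
      then have "norm (p (A (w + k) t) (u (w + k) t - u w t)) \<le> B * (K + L1) * norm (u (w + k) t - u w t)"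
        by (rule pb) simp
      moreover have "norm (p (A (w + k) t - A w t) (u w t)) \<le> B * (L1 * norm k) * M"
        by (rule pb[OF DA2[OF k(1) t] M(2)[OF t]])
      ultimately show "norm (p (A (w + k) t) (u (w + k) t) - p (A w t) (u w t)) \<le>
          B * (K + L1) * norm (u (w + k) t - u w t) + B * L1 * M * norm k"
        unfolding eq by (intro norm_triangle_le) (simp add: ac_simps)
    qed (use B L1 M K0 in \<open>auto simp: u0\<close>)
    then show ?thesis by (simp add: C_def ac_simps)
  qed
  show ?thesis
    unfolding has_derivative_at_alt
  proof (intro conjI allI impI lin)
    fix e :: real assume e: "e > 0"
    \<comment> \<open>\<open>X\<close> is the Gronwall factor. With \<open>\<eta>\<close> and
      \<open>d3\<close> each of the two error terms contributes e / 2: the Taylor remainder of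
      \<open>A\<close> acting on \<open>u w\<close>, and the product of the two increments.\<close>
    define X where "X = exp (B * K + 1)"
    have X: "X > 0" by (simp add: X_def)
    define \<eta> where "\<eta> = e / (2 * (B * M * X))"
    define d3 where "d3 = e / (2 * (B * L1 * C * X))"
    have \<eta>: "\<eta> > 0" and d3: "d3 > 0" using e B M X L1 C0 by (simp_all add: \<eta>_def d3_def)
    obtain d2 where d2: "d2 > 0"
      and DA3: "\<And>k t. norm k < d2 \<Longrightarrow> t \<in> {0..1} \<Longrightarrow>
        norm (A (w + k) t - A w t - DA t k) \<le> \<eta> * norm k"
      using DA[OF \<eta>] by auto
    define d where "d = Min {d1, d2, d3, \<delta>, 1}"
    have d: "d > 0" using d1 d2 d3 \<open>\<delta> > 0\<close> by (simp add: d_def)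
    have main: "norm (u (w + k) 1 - u w 1 - V k 1) \<le> e * norm k" if "norm k < d" for k
    proof -
      have k: "norm k < d1" "norm k < d2" "norm k < d3" "norm k < \<delta>" "norm k < 1"
        using that by (auto simp: d_def)
      have "norm (u (w + k) 1 - u w 1 - V k 1) \<le>
          (B * L1 * norm k * (C * norm k) + B * \<eta> * norm k * M) * exp (B * K + 1)"
      proof (rule gronwall_inner[where u = "\<lambda>t. u (w + k) t - u w t - V k t"])
        fix t :: real assume t: "t \<in> {0..1}"
        let ?E' = "p (A (w + k) t) (u (w + k) t) - p (A w t) (u w t) -
            (p (A w t) (V k t) + p (DA t k) (u w t))"
        show "((\<lambda>t. u (w + k) t - u w t - V k t) has_vector_derivative ?E') (at t within {0..1})"
          using k t \<open>\<delta> > 0\<close> by (intro has_vector_derivative_diff u V) (auto simp: dist_norm)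
        have eq: "?E' = p (A w t) (u (w + k) t - u w t - V k t) +
            (p (A (w + k) t - A w t) (u (w + k) t - u w t) +
             p (A (w + k) t - A w t - DA t k) (u w t))"
          by (simp add: p.diff_left p.diff_right)
        have 1: "norm (p (A w t) (u (w + k) t - u w t - V k t)) \<le>
            B * K * norm (u (w + k) t - u w t - V k t)"
          by (rule pb[OF K[OF t]]) simp
        have 2: "norm (p (A (w + k) t - A w t) (u (w + k) t - u w t)) \<le>
            B * (L1 * norm k) * (C * norm k)"
          by (rule pb[OF DA2[OF k(1) t] du[OF k(1,4,5) t]])
        have 3: "norm (p (A (w + k) t - A w t - DA t k) (u w t)) \<le> B * (\<eta> * norm k) * M"
          by (rule pb[OF DA3[OF k(2) t] M(2)[OF t]])
        show "norm ?E' \<le> B * K * norm (u (w + k) t - u w t - V k t) +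
            (B * L1 * norm k * (C * norm k) + B * \<eta> * norm k * M)"
          unfolding eq using 1 2 3
          by (intro norm_triangle_le add_mono) (auto simp: mult.assoc)
      qed (use B L1 M K0 C0 \<eta> in \<open>auto simp: u0 V0\<close>)
      also have "\<dots> = (B * L1 * C * X * norm k + B * M * X * \<eta>) * norm k"
        by (simp add: X_def algebra_simps)
      also have "\<dots> \<le> (B * L1 * C * X * d3 + B * M * X * \<eta>) * norm k"
        using k(3) B L1 C0 X by (intro mult_right_mono add_right_mono mult_left_mono) auto
      also have "B * L1 * C * X * d3 + B * M * X * \<eta> = e"
        using B L1 C0 X M by (simp add: d3_def \<eta>_def field_simps)
      finally show ?thesis .
    qed
    show "\<exists>d>0. \<forall>y. norm (y - w) < d \<longrightarrow>
        norm (u y 1 - u w 1 - V (y - w) 1) \<le> e * norm (y - w)"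
      using d main[of "_ - w"] by auto
  qed
qed

section \<open>Flat connections\<close>

lemma has_derivative_pdx_pdy:
  assumes "G differentiable (at w)"
  shows "(G has_derivative (\<lambda>k. Re k *\<^sub>R pdx G w + Im k *\<^sub>R pdy G w)) (at w)"
proof -
  let ?D = "frechet_derivative G (at w)"
  have D: "(G has_derivative ?D) (at w)"
    using assms frechet_derivative_works by blast
  then interpret bounded_linear ?D by (rule has_derivative_bounded_linear)
  have "?D k = Re k *\<^sub>R pdx G w + Im k *\<^sub>R pdy G w" for k
  proof -
    have "k = Re k *\<^sub>R 1 + Im k *\<^sub>R \<i>" by (simp add: complex_eq_iff)
    then have "?D k = ?D (Re k *\<^sub>R 1 + Im k *\<^sub>R \<i>)" by (rule arg_cong)
    then show ?thesis by (simp only: add scaleR pdx_def pdy_def)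
  qed
  then have "?D = (\<lambda>k. Re k *\<^sub>R pdx G w + Im k *\<^sub>R pdy G w)" by blast
  with D show ?thesis by argo
qed

lemma
  assumes "(G has_derivative D) (at w)"
  shows pdx_eqI: "pdx G w = D 1" and pdy_eqI: "pdy G w = D \<i>"
  using frechet_derivative_at[OF assms] by (simp_all add: pdx_def pdy_def)

lemma has_derivative_cong_open:
  assumes "open U" "w \<in> U" "\<And>v. v \<in> U \<Longrightarrow> F v = G v"
  shows "(F has_derivative D) (at w) \<longleftrightarrow> (G has_derivative D) (at w)"
  using has_derivative_transform_within_open[OF _ assms(1,2)] assms(3) by metis

text \<open>\<open>frechet_derivative\<close> is a choice among the maps that are derivatives at the
  point. Functions that agree near \<open>w\<close> have the same derivatives there, so the choices
  coincide, whether or not a derivative exists.\<close>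

lemma
  assumes "open U" "w \<in> U" "\<And>v. v \<in> U \<Longrightarrow> F v = G v"
  shows pdx_cong: "pdx F w = pdx G w" and pdy_cong: "pdy F w = pdy G w"
    and differentiable_cong_open: "F differentiable (at w) \<longleftrightarrow> G differentiable (at w)"
  using has_derivative_cong_open[OF assms]
  by (simp_all add: pdx_def pdy_def frechet_derivative_def differentiable_def)

text \<open>\<open>pdx\<close> and \<open>pdy\<close> yield functions on the whole plane, whereas
  product and chain rules are available only at points of \<open>U\<close>. This lemma lets those
  rules rewrite derivatives inside \<open>Ck_on\<close>.\<close>

lemma Ck_on_cong:
  assumes "open U" "\<And>v. v \<in> U \<Longrightarrow> F v = G v"
  shows "Ck_on k U F \<longleftrightarrow> Ck_on k U G"
  using assms(2)
proof (induction k arbitrary: F G)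
  case (Suc k)
  have "F differentiable (at w) \<longleftrightarrow> G differentiable (at w)" if "w \<in> U" for w
    by (rule differentiable_cong_open[OF assms(1) that Suc.prems])
  moreover have "Ck_on k U (pdx F) \<longleftrightarrow> Ck_on k U (pdx G)" "Ck_on k U (pdy F) \<longleftrightarrow> Ck_on k U (pdy G)"
    using pdx_cong[OF assms(1) _ Suc.prems] pdy_cong[OF assms(1) _ Suc.prems]
    by (auto intro!: Suc.IH)
  ultimately show ?case by simp
qed (simp cong: continuous_on_cong)

lemma Ck_on_Suc_imp: "Ck_on (Suc k) U G \<Longrightarrow> Ck_on k U G"
proof (induction k arbitrary: G)
  case 0
  then show ?case
    by (auto intro!: continuous_at_imp_continuous_on differentiable_imp_continuous_within)
next
  case (Suc k)
  from Suc.prems have "\<forall>w\<in>U. G differentiable (at w)"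
      "Ck_on (Suc k) U (pdx G)" "Ck_on (Suc k) U (pdy G)"
    unfolding Ck_on.simps(2)[of "Suc k"] by blast+
  then have "Ck_on k U (pdx G)" "Ck_on k U (pdy G)"
    using Suc.IH by blast+
  with \<open>\<forall>w\<in>U. G differentiable (at w)\<close> show ?case by simp
qed

lemma Ck_on_1D:
  assumes "Ck_on 1 U G"
  shows "continuous_on U G" "continuous_on U (pdx G)" "continuous_on U (pdy G)"
    "\<And>w. w \<in> U \<Longrightarrow> (G has_derivative (\<lambda>k. Re k *\<^sub>R pdx G w + Im k *\<^sub>R pdy G w)) (at w)"
  using assms Ck_on_Suc_imp[of 0 U G] has_derivative_pdx_pdy by auto

lemma Ck_on_1I:
  assumes U: "open U" and G: "\<And>w. w \<in> U \<Longrightarrow> (G has_derivative (\<lambda>k. Re k *\<^sub>R Gx w + Im k *\<^sub>R Gy w)) (at w)"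
    and c: "continuous_on U Gx" "continuous_on U Gy"
  shows "Ck_on 1 U G" "\<And>w. w \<in> U \<Longrightarrow> pdx G w = Gx w" "\<And>w. w \<in> U \<Longrightarrow> pdy G w = Gy w"
proof -
  show x: "\<And>w. w \<in> U \<Longrightarrow> pdx G w = Gx w"
    and y: "\<And>w. w \<in> U \<Longrightarrow> pdy G w = Gy w"
    using pdx_eqI[OF G] pdy_eqI[OF G] by auto
  show "Ck_on 1 U G"
    using c x y G by (auto simp: differentiable_def cong: continuous_on_cong)
qed

section \<open>Integration of flat linear systems\<close>

lemma norm_Re_Im_le:
  fixes a b :: "'m::real_normed_vector"
  assumes "norm a \<le> c" "norm b \<le> c"
  shows "norm (Re k *\<^sub>R a + Im k *\<^sub>R b) \<le> norm k * (2 * c)"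
proof -
  have "\<bar>Re k\<bar> * norm a \<le> norm k * c" "\<bar>Im k\<bar> * norm b \<le> norm k * c"
    using assms by (auto intro!: mult_mono abs_Re_le_cmod abs_Im_le_cmod)
  then show ?thesis
    using norm_triangle_ineq[of "Re k *\<^sub>R a" "Im k *\<^sub>R b"] by simp
qed

text \<open>The remainder must be small uniformly along a whole segment, hence over a compact set.
  The mean value inequality bounds it by the oscillation of the partial derivatives, which are
  uniformly continuous on a compact neighbourhood.\<close>

lemma C1_uniform_remainder:
  fixes P :: "complex \<Rightarrow> 'm::real_normed_vector"
  assumes D: "open D" and P: "Ck_on 1 D P" and K: "compact K" "K \<subseteq> D" and e: "e > 0"
  obtains d where "d > 0" "\<And>x k. x \<in> K \<Longrightarrow> norm k < d \<Longrightarrow>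
    norm (P (x + k) - P x - (Re k *\<^sub>R pdx P x + Im k *\<^sub>R pdy P x)) \<le> e * norm k"
proof -
  obtain r where r: "r > 0" "(\<Union>x\<in>K. cball x r) \<subseteq> D"
    using compact_subset_open_imp_cball_epsilon_subset[OF K(1) D K(2)] by blast
  \<comment> \<open>The points \<open>x + k\<close> leave \<open>K\<close>, so uniform continuity is
    taken on the set of points at distance at most \<open>r\<close> from \<open>K\<close>, which is
    still compact and inside \<open>D\<close>.\<close>
  define K' where "K' = {x + y | x y. x \<in> K \<and> y \<in> cball 0 r}"
  have K': "compact K'" unfolding K'_def using K(1) by (intro compact_sums) auto
  have K'D: "K' \<subseteq> D"
  proof
    fix v assume "v \<in> K'"
    then obtain x y where "v = x + y" "x \<in> K" "norm y \<le> r" by (auto simp: K'_def)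
    then have "v \<in> cball x r" by (simp add: dist_norm)
    then show "v \<in> D" using r(2) \<open>x \<in> K\<close> by blast
  qed
  have "uniformly_continuous_on K' (pdx P)" "uniformly_continuous_on K' (pdy P)"
    using Ck_on_1D(2,3)[OF P] K'D
    by (auto intro!: compact_uniformly_continuous K' intro: continuous_on_subset)
  then obtain d1 d2 where d12: "d1 > 0" "d2 > 0"
      and d1: "\<And>x y. x \<in> K' \<Longrightarrow> y \<in> K' \<Longrightarrow> dist y x < d1 \<Longrightarrow> dist (pdx P y) (pdx P x) < e / 2"
      and d2: "\<And>x y. x \<in> K' \<Longrightarrow> y \<in> K' \<Longrightarrow> dist y x < d2 \<Longrightarrow> dist (pdy P y) (pdy P x) < e / 2"
    unfolding uniformly_continuous_on_def using e by (metis half_gt_zero)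
  define d where "d = Min {r, d1, d2}"
  have d: "d > 0" using r d12 by (simp add: d_def)
  have "norm (P (x + k) - P x - (Re k *\<^sub>R pdx P x + Im k *\<^sub>R pdy P x)) \<le> e * norm k"
    if x: "x \<in> K" and k: "norm k < d" for x k
  proof -
    let ?P' = "\<lambda>y k. Re k *\<^sub>R pdx P y + Im k *\<^sub>R pdy P y"
    have inK: "y \<in> K'" if "y \<in> ball x d" for y
    proof -
      have "y = x + (y - x)" "y - x \<in> cball 0 r" using that by (auto simp: d_def dist_norm norm_minus_commute)
      then show ?thesis using x unfolding K'_def by blast
    qed
    have "norm (P (x + k) - P x - ?P' x (x + k - x)) \<le> norm (x + k - x) * e"
    proof (rule differentiable_bound_linearization[where S = "ball x d"])
      fix t :: real assume t: "t \<in> {0..1}"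
      have "t * norm k \<le> 1 * norm k" using t by (intro mult_right_mono) auto
      then show "x + t *\<^sub>R (x + k - x) \<in> ball x d"
        using t k by (simp add: dist_norm)
    next
      fix y assume y: "y \<in> ball x d"
      then have "y \<in> D" using inK K'D by blast
      then show "(P has_derivative ?P' y) (at y within ball x d)"
        using Ck_on_1D(4)[OF P] has_derivative_at_withinI by blast
      have "dist y x < d1" "dist y x < d2" using y by (auto simp: d_def dist_commute)
      then have b: "norm (pdx P y - pdx P x) < e / 2" "norm (pdy P y - pdy P x) < e / 2"
        using d1[of x y] d2[of x y] inK[OF y] inK[of x] d by (auto simp: dist_norm)
      show "onorm (?P' y - ?P' x) \<le> e"
      proof (rule onorm_bound)
        fix h :: complex
        have "(?P' y - ?P' x) h = Re h *\<^sub>R (pdx P y - pdx P x) + Im h *\<^sub>R (pdy P y - pdy P x)"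
          by (simp add: algebra_simps)
        also have "norm \<dots> \<le> norm h * (2 * (e / 2))"
          using b by (intro norm_Re_Im_le less_imp_le)
        finally show "norm ((?P' y - ?P' x) h) \<le> e * norm h" by (simp add: mult.commute)
      qed (use e in auto)
    qed (use d in auto)
    then show ?thesis by (simp add: mult.commute)
  qed
  then show ?thesis using that d by blast
qed

text \<open>The form \<open>P dx + Q dy\<close> and its derivative in the direction \<open>k\<close>.\<close>

definition one_form where
  "one_form P Q x v = Re v *\<^sub>R P x + Im v *\<^sub>R Q x"

definition d_one_form where
  "d_one_form P Q x k v = Re v *\<^sub>R (Re k *\<^sub>R pdx P x + Im k *\<^sub>R pdy P x)
    + Im v *\<^sub>R (Re k *\<^sub>R pdx Q x + Im k *\<^sub>R pdy Q x)"

text \<open>The difference of the two sides is real bilinear and alternating in \<open>k\<close> and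
  \<open>l\<close>, hence a multiple of its value at the pair 1, \<i>, where it vanishes by
  \<open>flat\<close>. The form with arbitrary directions is the one that the variational equation
  and the pull-back need.\<close>

lemma flat_one_form:
  fixes p :: "'m::real_normed_vector \<Rightarrow> 'e::real_normed_vector \<Rightarrow> 'e"
  assumes "bounded_bilinear p"
    and flat: "\<And>v. p (pdx Q x) v + p (Q x) (p (P x) v) = p (pdy P x) v + p (P x) (p (Q x) v)"
  shows "p (d_one_form P Q x k l) v + p (one_form P Q x l) (p (one_form P Q x k) v) =
    p (d_one_form P Q x l k) v + p (one_form P Q x k) (p (one_form P Q x l) v)"
proof -
  interpret p: bounded_bilinear p by fact
  have f: "p (pdx Q x) v = p (pdy P x) v + p (P x) (p (Q x) v) - p (Q x) (p (P x) v)"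
    using flat[of v] by (simp add: algebra_simps)
  show ?thesis
    unfolding one_form_def d_one_form_def
    by (simp add: p.add_left p.add_right p.scaleR_left p.scaleR_right f) (simp add: algebra_simps)
qed

text \<open>
  Integrate along the rays from \<open>0\<close>.  By flatness \<open>V k t = t \<omega>(t w)(k) u\<^sub>w(t)\<close> solves the variational
  equation of \<open>u\<^sub>w\<close>, hence is the derivative of \<open>u\<^sub>w(t)\<close> with respect to \<open>w\<close>.
\<close>

theorem frobenius_star_shaped:
  fixes p :: "'m::real_normed_vector \<Rightarrow> 'e::euclidean_space \<Rightarrow> 'e"
  assumes p: "bounded_bilinear p" and D: "open D" "0 \<in> D"
    and star: "\<And>w t. w \<in> D \<Longrightarrow> t \<in> {0..1} \<Longrightarrow> t *\<^sub>R w \<in> D"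
    and PQ: "Ck_on 1 D P" "Ck_on 1 D Q"
    and flat: "\<And>w v. w \<in> D \<Longrightarrow>
      p (pdx Q w) v + p (Q w) (p (P w) v) = p (pdy P w) v + p (P w) (p (Q w) v)"
  obtains \<Phi> where "\<Phi> 0 = u0"
    "\<And>w. w \<in> D \<Longrightarrow> (\<Phi> has_derivative (\<lambda>k. p (one_form P Q w k) (\<Phi> w))) (at w)"
proof -
  interpret p: bounded_bilinear p by (fact p)
  note [continuous_intros] =
    continuous_on_compose2[OF Ck_on_1D(1)[OF PQ(1)]] continuous_on_compose2[OF Ck_on_1D(1)[OF PQ(2)]]
  \<comment> \<open>Coefficient of the system restricted to the segment from 0 to \<open>v\<close>,
    which is run through with velocity \<open>v\<close>.\<close>
  define A where "A v t = one_form P Q (t *\<^sub>R v) v" for v t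
  have Ac: "continuous_on {0..1} (A v)" if "v \<in> D" for v
    unfolding A_def one_form_def using star[OF that] by (auto intro!: continuous_intros)
  \<comment> \<open>The initial value is claimed for every \<open>v\<close>, also outside
    \<open>D\<close>, so that the choice of \<open>u\<close> gives \<open>u v 0 = u0\<close> without
    a side condition, as \<open>ode_parameter_derivative\<close> expects it.\<close>
  have "\<exists>u. u 0 = u0 \<and> (v \<in> D \<longrightarrow> (\<forall>t\<in>{0..1}.
      (u has_vector_derivative p (A v t) (u t)) (at t within {0..1})))" for v
  proof (cases "v \<in> D")
    case True
    then show ?thesis using linear_ode_exists[OF p Ac, of v u0] by metis
  qed auto
  then obtain u where u0: "\<And>v. u v 0 = u0"
    and u: "\<And>v t. v \<in> D \<Longrightarrow> t \<in> {0..1} \<Longrightarrow>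
      (u v has_vector_derivative p (A v t) (u v t)) (at t within {0..1})"
    by metis
  have "((\<lambda>v. u v 1) has_derivative (\<lambda>k. p (one_form P Q w k) (u w 1))) (at w)" if w: "w \<in> D" for w
  proof -
    define K where "K = (\<lambda>t. t *\<^sub>R w) ` {0..1::real}"
    have K: "compact K" unfolding K_def
      by (intro compact_continuous_image continuous_intros) auto
    have KD: "K \<subseteq> D" using star[OF w] by (auto simp: K_def)
    have tK: "t *\<^sub>R w \<in> K" if "t \<in> {0..1}" for t using that by (auto simp: K_def)
    have "bounded (g ` K)" if "continuous_on D g" for g :: "complex \<Rightarrow> 'm"
      using that KD K by (meson compact_continuous_image compact_imp_bounded continuous_on_subset)
    then have bd: "\<exists>M. \<forall>x\<in>K. norm (g x) \<le> M" if "continuous_on D g" for g :: "complex \<Rightarrow> 'm"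
      using that by (simp add: bounded_iff)
    obtain m1 where m1: "\<And>x. x \<in> K \<Longrightarrow> norm (P x) \<le> m1"
      using bd[OF Ck_on_1D(1)[OF PQ(1)]] by blast
    obtain m2 where m2: "\<And>x. x \<in> K \<Longrightarrow> norm (pdx P x) \<le> m2"
      using bd[OF Ck_on_1D(2)[OF PQ(1)]] by blast
    obtain m3 where m3: "\<And>x. x \<in> K \<Longrightarrow> norm (pdy P x) \<le> m3"
      using bd[OF Ck_on_1D(3)[OF PQ(1)]] by blast
    obtain m4 where m4: "\<And>x. x \<in> K \<Longrightarrow> norm (Q x) \<le> m4"
      using bd[OF Ck_on_1D(1)[OF PQ(2)]] by blast
    obtain m5 where m5: "\<And>x. x \<in> K \<Longrightarrow> norm (pdx Q x) \<le> m5"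
      using bd[OF Ck_on_1D(2)[OF PQ(2)]] by blast
    obtain m6 where m6: "\<And>x. x \<in> K \<Longrightarrow> norm (pdy Q x) \<le> m6"
      using bd[OF Ck_on_1D(3)[OF PQ(2)]] by blast
    note m = m1 m2 m3 m4 m5 m6
    define M where "M = 1 + \<bar>m1\<bar> + \<bar>m2\<bar> + \<bar>m3\<bar> + \<bar>m4\<bar> + \<bar>m5\<bar> + \<bar>m6\<bar>"
    have M: "norm (P x) \<le> M" "norm (pdx P x) \<le> M" "norm (pdy P x) \<le> M"
      "norm (Q x) \<le> M" "norm (pdx Q x) \<le> M" "norm (pdy Q x) \<le> M" if "x \<in> K" for x
      using m[OF that] unfolding M_def by linarith+
    have M0: "M > 0" unfolding M_def by linarith
    \<comment> \<open>Product rule for \<open>A v t\<close>, in which \<open>v\<close> occurs twice: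
      linearly as the velocity, and through the base point, whose variation is t k.\<close>
    define DA where "DA t k = one_form P Q (t *\<^sub>R w) k + t *\<^sub>R d_one_form P Q (t *\<^sub>R w) k w" for t k
    have om_le: "norm (one_form P Q x k) \<le> norm k * (2 * M)" if "x \<in> K" for x k
      unfolding one_form_def by (rule norm_Re_Im_le[OF M(1,4)[OF that]])
    define V where "V k t = t *\<^sub>R p (one_form P Q (t *\<^sub>R w) k) (u w t)" for k t
    obtain \<delta> where \<delta>: "\<delta> > 0" "ball w \<delta> \<subseteq> D" using D(1) w openE by blast
    have "((\<lambda>v. u v 1) has_derivative (\<lambda>k. V k 1)) (at w)"
    proof (rule ode_parameter_derivative[where u = u and ?u0.0 = u0 and V = V and A = A and DA = DA and K = "norm w * (2 * M)" and L = "2 * M + norm w * (4 * M)",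
          OF p \<delta>(1) _ u0])
      show "(u v has_vector_derivative p (A v t) (u v t)) (at t within {0..1})"
        if "dist v w < \<delta>" "t \<in> {0..1}" for v t
        using that \<delta>(2) by (intro u) (auto simp: dist_commute)
      show "norm (A w t) \<le> norm w * (2 * M)" if "t \<in> {0..1}" for t
        unfolding A_def by (rule om_le[OF tK[OF that]])
      show "norm (DA t k) \<le> (2 * M + norm w * (4 * M)) * norm k" if t: "t \<in> {0..1}" for t k
      proof -
        have "norm (d_one_form P Q (t *\<^sub>R w) k w) \<le> norm w * (2 * (norm k * (2 * M)))"
          unfolding d_one_form_def by (intro norm_Re_Im_le M tK t)
        then have "t * norm (d_one_form P Q (t *\<^sub>R w) k w) \<le> 1 * (norm w * (2 * (norm k * (2 * M))))"
          using t by (intro mult_mono) auto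
        then have "norm (DA t k) \<le> norm k * (2 * M) + norm w * (2 * (norm k * (2 * M)))"
          unfolding DA_def using om_le[OF tK[OF t], of k] t by (intro norm_triangle_le add_mono) auto
        then show ?thesis by (simp add: algebra_simps)
      qed
      show "0 \<le> 2 * M + norm w * (4 * M)" using M0 by simp
      show "V k 0 = 0" for k by (simp add: V_def)
      show "bounded_linear (\<lambda>k. V k 1)"
        unfolding V_def one_form_def
        by (auto intro!: bounded_linear_intros bounded_linear_Re bounded_linear_Im bounded_linear_compose[OF p.bounded_linear_left])
      show "(V k has_vector_derivative p (A w t) (V k t) + p (DA t k) (u w t)) (at t within {0..1})"
        if t: "t \<in> {0..1}" for k t
      proof -
        let ?x = "t *\<^sub>R w"
        have x: "?x \<in> D" using star[OF w t] .
        have tw: "((\<lambda>t. t *\<^sub>R w) has_vector_derivative w) (at t within {0..1})"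
          by (auto intro!: derivative_eq_intros)
        have dP: "((\<lambda>t. R (t *\<^sub>R w)) has_vector_derivative (Re w *\<^sub>R pdx R ?x + Im w *\<^sub>R pdy R ?x))
            (at t within {0..1})" if R: "Ck_on 1 D R" for R :: "complex \<Rightarrow> 'm"
          using vector_derivative_diff_chain_within[OF tw
              has_derivative_at_withinI[OF Ck_on_1D(4)[OF R x]]] by (simp add: o_def)
        have dom1: "((\<lambda>t. one_form P Q (t *\<^sub>R w) k) has_vector_derivative d_one_form P Q ?x w k) (at t within {0..1})"
          unfolding one_form_def d_one_form_def
          by (intro has_vector_derivative_add bounded_linear.has_vector_derivative[OF bounded_linear_scaleR_right] dP PQ)
        have "(V k has_vector_derivative (t *\<^sub>R (p (one_form P Q ?x k) (p (A w t) (u w t)) + p (d_one_form P Q ?x w k) (u w t))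
            + 1 *\<^sub>R p (one_form P Q ?x k) (u w t))) (at t within {0..1})"
          unfolding V_def
          by (intro has_vector_derivative_scaleR p.has_vector_derivative dom1 u w t) auto
        moreover have "t *\<^sub>R (p (one_form P Q ?x k) (p (A w t) (u w t)) + p (d_one_form P Q ?x w k) (u w t))
            + 1 *\<^sub>R p (one_form P Q ?x k) (u w t) = p (A w t) (V k t) + p (DA t k) (u w t)"
        proof -
          \<comment> \<open>Differentiating \<open>V k\<close> along the segment produces the
            derivative of the form in direction \<open>w\<close>, evaluated at \<open>k\<close>; the
            variational equation contains the derivative in direction \<open>k\<close>, evaluated at
            \<open>w\<close>. Flatness exchanges the two, at the price of exactly the commutator
            that also arises.\<close>
          have "p (d_one_form P Q ?x w k) (u w t) + p (one_form P Q ?x k) (p (one_form P Q ?x w) (u w t)) =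
              p (d_one_form P Q ?x k w) (u w t) + p (one_form P Q ?x w) (p (one_form P Q ?x k) (u w t))"
            by (rule flat_one_form[OF p flat[OF x]])
          from arg_cong[OF this, of "\<lambda>y. t *\<^sub>R y"] show ?thesis
            unfolding V_def DA_def A_def
            by (simp add: p.add_left p.scaleR_left p.scaleR_right scaleR_add_right add.commute)
        qed
        ultimately show ?thesis by simp
      qed
      show "\<exists>d>0. \<forall>k. norm k < d \<longrightarrow> (\<forall>t\<in>{0..1}. norm (A (w + k) t - A w t - DA t k) \<le> e * norm k)"
        if e: "e > 0" for e
      proof -
        \<comment> \<open>The remainder of \<open>A\<close> consists of the Taylor remainders of
          \<open>P\<close> and \<open>Q\<close> weighted by \<open>w\<close> and of their increments
          weighted by \<open>k\<close>. \<open>\<eta>\<close> and \<open>d3\<close> make each part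
          at most e / 2 times |k|; the 1 added to |w| covers w = 0.\<close>
        define \<eta> where "\<eta> = e / (4 * (norm w + 1))"
        have \<eta>: "\<eta> > 0" unfolding \<eta>_def using e by (simp add: add_nonneg_pos)
        obtain d1 where d1: "d1 > 0" "\<And>x k. x \<in> K \<Longrightarrow> norm k < d1 \<Longrightarrow>
            norm (P (x + k) - P x - (Re k *\<^sub>R pdx P x + Im k *\<^sub>R pdy P x)) \<le> \<eta> * norm k"
          using C1_uniform_remainder[OF D(1) PQ(1) K KD \<eta>] by blast
        obtain d2 where d2: "d2 > 0" "\<And>x k. x \<in> K \<Longrightarrow> norm k < d2 \<Longrightarrow>
            norm (Q (x + k) - Q x - (Re k *\<^sub>R pdx Q x + Im k *\<^sub>R pdy Q x)) \<le> \<eta> * norm k"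
          using C1_uniform_remainder[OF D(1) PQ(2) K KD \<eta>] by blast
        define d3 where "d3 = e / (4 * (\<eta> + 2 * M))"
        have d3: "d3 > 0" using e \<eta> M0 by (simp add: d3_def)
        have "norm (A (w + k) t - A w t - DA t k) \<le> e * norm k"
          if k: "norm k < Min {d1, d2, d3}" and t: "t \<in> {0..1}" for k t
        proof -
          let ?x = "t *\<^sub>R w" and ?h = "t *\<^sub>R k"
          have tk: "norm ?h \<le> norm k" using t by (simp add: mult_left_le_one_le)
          define rP where "rP = P (?x + ?h) - P ?x - (Re ?h *\<^sub>R pdx P ?x + Im ?h *\<^sub>R pdy P ?x)"
          define rQ where "rQ = Q (?x + ?h) - Q ?x - (Re ?h *\<^sub>R pdx Q ?x + Im ?h *\<^sub>R pdy Q ?x)"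
          have "norm rP \<le> \<eta> * norm ?h" "norm rQ \<le> \<eta> * norm ?h"
            unfolding rP_def rQ_def
            by (rule d1(2)[OF tK[OF t]] d2(2)[OF tK[OF t]], use tk k in simp)+
          then have r: "norm rP \<le> \<eta> * norm k" "norm rQ \<le> \<eta> * norm k"
            using mult_left_mono[OF tk less_imp_le[OF \<eta>]] by linarith+
          have "norm (Re ?h *\<^sub>R pdx P ?x + Im ?h *\<^sub>R pdy P ?x) \<le> norm ?h * (2 * M)"
            "norm (Re ?h *\<^sub>R pdx Q ?x + Im ?h *\<^sub>R pdy Q ?x) \<le> norm ?h * (2 * M)"
            by (intro norm_Re_Im_le M tK t)+
          moreover have "norm ?h * (2 * M) \<le> norm k * (2 * M)"
            using tk M0 by (intro mult_right_mono) auto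
          ultimately have "norm (P (?x + ?h) - P ?x) \<le> (\<eta> + 2 * M) * norm k"
              "norm (Q (?x + ?h) - Q ?x) \<le> (\<eta> + 2 * M) * norm k"
            using r norm_triangle_ineq[of rP "Re ?h *\<^sub>R pdx P ?x + Im ?h *\<^sub>R pdy P ?x"]
              norm_triangle_ineq[of rQ "Re ?h *\<^sub>R pdx Q ?x + Im ?h *\<^sub>R pdy Q ?x"]
            by (simp_all add: rP_def rQ_def algebra_simps)
          moreover have "(\<eta> + 2 * M) * norm k \<le> (\<eta> + 2 * M) * d3"
            using k \<eta> M0 by (intro mult_left_mono) auto
          moreover have "(\<eta> + 2 * M) * d3 = e / 4"
            using \<eta> M0 by (simp add: d3_def field_simps)
          ultimately have d: "norm (P (?x + ?h) - P ?x) \<le> e / 4" "norm (Q (?x + ?h) - Q ?x) \<le> e / 4"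
            by auto
          have eq: "A (w + k) t - A w t - DA t k =
              (Re w *\<^sub>R rP + Im w *\<^sub>R rQ) +
              (Re k *\<^sub>R (P (?x + ?h) - P ?x) + Im k *\<^sub>R (Q (?x + ?h) - Q ?x))"
            unfolding A_def DA_def one_form_def d_one_form_def rP_def rQ_def
            by (simp add: algebra_simps)
          have "norm (A (w + k) t - A w t - DA t k) \<le>
              norm w * (2 * (\<eta> * norm k)) + norm k * (2 * (e / 4))"
            unfolding eq by (intro norm_triangle_le add_mono norm_Re_Im_le r d)
          also have "norm w * (2 * (\<eta> * norm k)) = (norm w * \<eta>) * (2 * norm k)" by simp
          also have "\<dots> \<le> (e / 4) * (2 * norm k)"
            unfolding \<eta>_def using e by (intro mult_right_mono) (auto simp: field_simps add_pos_nonneg)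
          finally show ?thesis by (simp add: field_simps)
        qed
        then show ?thesis using d1(1) d2(1) d3 by (intro exI[of _ "Min {d1, d2, d3}"]) auto
      qed
    qed
    then show ?thesis by (simp add: V_def)
  qed
  \<comment> \<open>The segment belonging to 0 has velocity 0, so the solution along it is
    constant.\<close>
  moreover have "u 0 1 = u0"
  proof -
    have "(u 0 has_vector_derivative 0) (at t within {0..1})" if "t \<in> {0..1}" for t
      using u[OF D(2) that] by (simp add: A_def one_form_def p.zero_left)
    then obtain c where "\<And>t. t \<in> {0..1} \<Longrightarrow> u 0 t = c"
      using has_vector_derivative_zero_constant[of "{0..1}" "u 0"] by auto
    from this[of 0] this[of 1] show ?thesis using u0 by simp
  qed
  ultimately show ?thesis
    using that[of "\<lambda>v. u v 1"] by blast
qed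

text \<open>The Riemann map turns \<open>U\<close> into a disc, and pulling back a form preserves flatness.\<close>

theorem frobenius_simply_connected:
  fixes p :: "'m::real_normed_vector \<Rightarrow> 'e::euclidean_space \<Rightarrow> 'e"
  assumes p: "bounded_bilinear p" and U: "open U" "simply_connected U" "U \<noteq> {}"
    and PQ: "Ck_on 1 U P" "Ck_on 1 U Q"
    and flat: "\<And>w v. w \<in> U \<Longrightarrow>
      p (pdx Q w) v + p (Q w) (p (P w) v) = p (pdy P w) v + p (P w) (p (Q w) v)"
  obtains w0 \<Phi> where "w0 \<in> U" "\<Phi> w0 = u0"
    "\<And>w. w \<in> U \<Longrightarrow> (\<Phi> has_derivative (\<lambda>k. p (one_form P Q w k) (\<Phi> w))) (at w)"
proof -
  interpret p: bounded_bilinear p by (fact p)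
  let ?om = "one_form P Q" and ?dom = "d_one_form P Q"
  \<comment> \<open>The Riemann mapping theorem leaves out the whole plane, but the plane is
    star-shaped itself and is paired with the identity. In both cases \<open>D\<close> is
    star-shaped about 0.\<close>
  have "\<exists>D h g. open D \<and> 0 \<in> D \<and> (\<forall>w\<in>D. \<forall>t\<in>{0..1::real}. t *\<^sub>R w \<in> D) \<and>
      h holomorphic_on U \<and> g holomorphic_on D \<and> (\<forall>w\<in>U. h w \<in> D \<and> g (h w) = w) \<and> (\<forall>x\<in>D. g x \<in> U \<and> h (g x) = x)"
  proof (cases "U = UNIV")
    case True
    then show ?thesis
      by (intro exI[of _ UNIV] exI[of _ id]) (auto intro!: holomorphic_intros)
  next
    case False
    then obtain h g where hg: "h holomorphic_on U" "g holomorphic_on ball 0 1"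
        "\<forall>w\<in>U. h w \<in> ball 0 1 \<and> g (h w) = w" "\<forall>x\<in>ball 0 1. g x \<in> U \<and> h (g x) = x"
      using simply_connected_eq_biholomorphic_to_disc[OF U(1)] U(2,3) by blast
    have "t *\<^sub>R w \<in> ball 0 1" if "w \<in> ball 0 1" "t \<in> {0..1}" for w :: complex and t :: real
      using that mult_left_le_one_le[of "norm w" t] by auto
    then show ?thesis
      using hg by (intro exI[of _ "ball 0 1"] exI[of _ h] exI[of _ g]) auto
  qed
  then obtain D h g where D: "open D" "0 \<in> D" "\<And>w t. w \<in> D \<Longrightarrow> t \<in> {0..1::real} \<Longrightarrow> t *\<^sub>R w \<in> D"
    and h: "h holomorphic_on U" and g: "g holomorphic_on D"
    and hD: "\<And>w. w \<in> U \<Longrightarrow> h w \<in> D" and gh: "\<And>w. w \<in> U \<Longrightarrow> g (h w) = w"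
    and gU: "\<And>x. x \<in> D \<Longrightarrow> g x \<in> U" and hg: "\<And>x. x \<in> D \<Longrightarrow> h (g x) = x"
    by blast
  let ?g' = "deriv g" and ?g'' = "deriv (deriv g)"
  have g': "?g' holomorphic_on D" and g'': "?g'' holomorphic_on D"
    using g D(1) by (auto intro!: holomorphic_deriv)
  note cont = holomorphic_on_imp_continuous_on[OF g] holomorphic_on_imp_continuous_on[OF g']
    holomorphic_on_imp_continuous_on[OF g'']
  \<comment> \<open>\<open>R m\<close> is the pulled-back form evaluated at the constant vector
    \<open>m\<close>, so \<open>R 1\<close> and \<open>R \<i>\<close> are its coefficients: the
    differential of \<open>g\<close> is multiplication by \<open>deriv g\<close>.
    \<open>Rd m l\<close> is the derivative of \<open>R m\<close> in direction
    \<open>l\<close>.\<close>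
  define R where "R m x = ?om (g x) (m * ?g' x)" for m x
  define Rd where "Rd m l x = ?dom (g x) (l * ?g' x) (m * ?g' x) + ?om (g x) (m * (l * ?g'' x))" for m l x
  have Rder: "(R m has_derivative (\<lambda>k. Re k *\<^sub>R Rd m 1 x + Im k *\<^sub>R Rd m \<i> x)) (at x)" if x: "x \<in> D" for m x
  proof -
    have dg: "(g has_derivative (\<lambda>k. ?g' x * k)) (at x)" "(?g' has_derivative (\<lambda>k. ?g'' x * k)) (at x)"
      using holomorphic_derivI[OF g D(1) x] holomorphic_derivI[OF g' D(1) x]
      by (auto simp: has_field_derivative_def)
    have dF: "((\<lambda>x. F (g x)) has_derivative
        (\<lambda>k. Re (?g' x * k) *\<^sub>R pdx F (g x) + Im (?g' x * k) *\<^sub>R pdy F (g x))) (at x)"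
      if "Ck_on 1 U F" for F :: "complex \<Rightarrow> 'm"
      using diff_chain_at[OF dg(1) Ck_on_1D(4)[OF that gU[OF x]]] by (simp add: o_def)
    show ?thesis
      unfolding R_def one_form_def
      by (rule has_derivative_eq_rhs, (rule derivative_intros dF PQ dg)+)
        (simp add: Rd_def one_form_def d_one_form_def fun_eq_iff algebra_simps)
  qed
  have "continuous_on D (Rd m l)" for m l
  proof -
    have "continuous_on D (\<lambda>x. F (g x))" if "continuous_on U F" for F :: "complex \<Rightarrow> 'm"
      using that gU by (intro continuous_on_compose2[OF that cont(1)]) auto
    from this[OF Ck_on_1D(1)[OF PQ(1)]] this[OF Ck_on_1D(1)[OF PQ(2)]]
      this[OF Ck_on_1D(2)[OF PQ(1)]] this[OF Ck_on_1D(2)[OF PQ(2)]]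
      this[OF Ck_on_1D(3)[OF PQ(1)]] this[OF Ck_on_1D(3)[OF PQ(2)]]
    show ?thesis
      unfolding Rd_def[abs_def] one_form_def d_one_form_def by (intro continuous_intros cont)
  qed
  then have R: "Ck_on 1 D (R m)" and Rx: "x \<in> D \<Longrightarrow> pdx (R m) x = Rd m 1 x"
    and Ry: "x \<in> D \<Longrightarrow> pdy (R m) x = Rd m \<i> x" for m x
    using Ck_on_1I[OF D(1) Rder] by blast+
  \<comment> \<open>Flatness of the original form is used at the directions g' and \<i> g'. The
    terms with g'' agree on both sides, because they depend on the two directions only through their
    product.\<close>
  have flatR: "p (pdx (R \<i>) x) v + p (R \<i> x) (p (R 1 x) v) = p (pdy (R 1) x) v + p (R 1 x) (p (R \<i> x) v)"
    if x: "x \<in> D" for x v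
    using flat_one_form[OF p flat[OF gU[OF x]], of "?g' x" "\<i> * ?g' x" v]
    unfolding Rx[OF x] Ry[OF x] R_def Rd_def by (simp add: p.add_left algebra_simps)
  obtain \<Psi> where \<Psi>: "\<Psi> 0 = u0"
      "\<And>x. x \<in> D \<Longrightarrow> (\<Psi> has_derivative (\<lambda>k. p (one_form (R 1) (R \<i>) x k) (\<Psi> x))) (at x)"
    using frobenius_star_shaped[OF p D R R flatR, of u0] by blast
  have gR: "one_form (R 1) (R \<i>) x k = ?om (g x) (k * ?g' x)" for x k
    by (simp add: one_form_def R_def algebra_simps)
  have dh: "(h has_derivative (\<lambda>k. deriv h w * k)) (at w)" if "w \<in> U" for w
    using holomorphic_derivI[OF h U(1) that] by (auto simp: has_field_derivative_def)
  \<comment> \<open>By this identity, pulling back along \<open>h\<close> cancels the pull-back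
    along \<open>g\<close>.\<close>
  have inv: "?g' (h w) * deriv h w = 1" if w: "w \<in> U" for w
  proof (rule DERIV_unique)
    show "(g \<circ> h has_field_derivative ?g' (h w) * deriv h w) (at w)"
      by (intro DERIV_chain holomorphic_derivI[OF g D(1) hD] holomorphic_derivI[OF h U(1)] w)
    show "(g \<circ> h has_field_derivative 1) (at w)"
      using has_field_derivative_transform_within_open[OF DERIV_ident U(1) w, of "g \<circ> h"] gh by simp
  qed
  show ?thesis
  proof (rule that)
    show "g 0 \<in> U" using gU D(2) by blast
    show "(\<Psi> \<circ> h) (g 0) = u0" by (simp add: hg D(2) \<Psi>)
    fix w assume w: "w \<in> U"
    have "one_form (R 1) (R \<i>) (h w) (deriv h w * k) = ?om w k" for k
      using inv[OF w] by (simp add: gR gh[OF w] mult.commute mult.left_commute)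
    then show "(\<Psi> \<circ> h has_derivative (\<lambda>k. p (?om w k) ((\<Psi> \<circ> h) w))) (at w)"
      using diff_chain_at[OF dh[OF w] \<Psi>(2)[OF hD[OF w]]] by (simp add: o_def)
  qed
qed

section \<open>Smooth functions on plane domains\<close>

lemma Ck_on_const: "Ck_on k U (\<lambda>w. c)"
proof (induction k arbitrary: c)
  case (Suc k)
  have "pdx (\<lambda>w. c) = (\<lambda>w. 0)" "pdy (\<lambda>w. c) = (\<lambda>w. 0)"
    using pdx_eqI[OF has_derivative_const] pdy_eqI[OF has_derivative_const] by blast+
  then show ?case using Suc.IH[of 0] by simp
qed simp

lemma
  assumes f: "bounded_linear f" and G: "G differentiable (at w)"
  shows pdx_linear: "pdx (\<lambda>w. f (G w)) w = f (pdx G w)"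
    and pdy_linear: "pdy (\<lambda>w. f (G w)) w = f (pdy G w)"
    and differentiable_linear: "(\<lambda>w. f (G w)) differentiable (at w)"
  using bounded_linear.has_derivative[OF f has_derivative_pdx_pdy[OF G]]
  by (auto simp: pdx_eqI pdy_eqI differentiable_def)

lemma Ck_on_linear:
  assumes U: "open U" and f: "bounded_linear f" and G: "Ck_on k U G"
  shows "Ck_on k U (\<lambda>w. f (G w))"
  using G
proof (induction k arbitrary: G)
  case 0
  then show ?case by (simp add: bounded_linear.continuous_on[OF f])
next
  case (Suc k)
  have "Ck_on k U (pdx (\<lambda>w. f (G w))) \<longleftrightarrow> Ck_on k U (\<lambda>w. f (pdx G w))"
    "Ck_on k U (pdy (\<lambda>w. f (G w))) \<longleftrightarrow> Ck_on k U (\<lambda>w. f (pdy G w))"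
    using Suc.prems by (auto intro!: Ck_on_cong[OF U] pdx_linear[OF f] pdy_linear[OF f])
  then show ?case using Suc differentiable_linear[OF f] by auto
qed

lemma
  assumes F: "F differentiable (at w)" and G: "G differentiable (at w)"
  shows pdx_add: "pdx (\<lambda>w. F w + G w) w = pdx F w + pdx G w"
    and pdy_add: "pdy (\<lambda>w. F w + G w) w = pdy F w + pdy G w"
  using has_derivative_add[OF has_derivative_pdx_pdy[OF F] has_derivative_pdx_pdy[OF G]]
  by (auto simp: pdx_eqI pdy_eqI)

lemma Ck_on_add:
  assumes U: "open U" and "Ck_on k U F" "Ck_on k U G"
  shows "Ck_on k U (\<lambda>w. F w + G w)"
  using assms(2,3)
proof (induction k arbitrary: F G)
  case 0
  then show ?case by (simp add: continuous_on_add)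
next
  case (Suc k)
  have "Ck_on k U (pdx (\<lambda>w. F w + G w)) \<longleftrightarrow> Ck_on k U (\<lambda>w. pdx F w + pdx G w)"
    "Ck_on k U (pdy (\<lambda>w. F w + G w)) \<longleftrightarrow> Ck_on k U (\<lambda>w. pdy F w + pdy G w)"
    using Suc.prems by (auto intro!: Ck_on_cong[OF U] pdx_add pdy_add)
  then show ?case using Suc by auto
qed

text \<open>An arbitrary bounded bilinear operation is allowed, so that one Leibniz rule serves
  products of functions, scalar multiples, inner products and matrix products.\<close>

lemma
  assumes p: "bounded_bilinear p" and F: "F differentiable (at w)" and G: "G differentiable (at w)"
  shows pdx_bilinear: "pdx (\<lambda>w. p (F w) (G w)) w = p (F w) (pdx G w) + p (pdx F w) (G w)"
    and pdy_bilinear: "pdy (\<lambda>w. p (F w) (G w)) w = p (F w) (pdy G w) + p (pdy F w) (G w)"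
    and differentiable_bilinear: "(\<lambda>w. p (F w) (G w)) differentiable (at w)"
  using bounded_bilinear.FDERIV[OF p has_derivative_pdx_pdy[OF F] has_derivative_pdx_pdy[OF G]]
  by (auto simp: pdx_eqI pdy_eqI differentiable_def)

lemma Ck_on_bilinear:
  assumes U: "open U" and p: "bounded_bilinear p" and "Ck_on k U F" "Ck_on k U G"
  shows "Ck_on k U (\<lambda>w. p (F w) (G w))"
  using assms(3,4)
proof (induction k arbitrary: F G)
  case 0
  then show ?case by (simp add: bounded_bilinear.continuous_on[OF p])
next
  case (Suc k)
  have "Ck_on k U (pdx (\<lambda>w. p (F w) (G w))) \<longleftrightarrow> Ck_on k U (\<lambda>w. p (F w) (pdx G w) + p (pdx F w) (G w))"
    "Ck_on k U (pdy (\<lambda>w. p (F w) (G w))) \<longleftrightarrow> Ck_on k U (\<lambda>w. p (F w) (pdy G w) + p (pdy F w) (G w))"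
    using Suc.prems by (auto intro!: Ck_on_cong[OF U] pdx_bilinear[OF p] pdy_bilinear[OF p])
  then show ?case
    using Suc differentiable_bilinear[OF p] Ck_on_Suc_imp[OF Suc.prems(1)] Ck_on_Suc_imp[OF Suc.prems(2)]
    by (auto intro!: Ck_on_add[OF U])
qed

lemma
  fixes g :: "real \<Rightarrow> real"
  assumes g: "DERIV g (F w) :> d" and F: "F differentiable (at w)"
  shows pdx_chain: "pdx (\<lambda>w. g (F w)) w = d * pdx F w"
    and pdy_chain: "pdy (\<lambda>w. g (F w)) w = d * pdy F w"
    and differentiable_chain_real: "(\<lambda>w. g (F w)) differentiable (at w)"
proof -
  have "((\<lambda>w. g (F w)) has_derivative (\<lambda>k. d * (Re k *\<^sub>R pdx F w + Im k *\<^sub>R pdy F w))) (at w)"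
    using diff_chain_at[OF has_derivative_pdx_pdy[OF F] g[unfolded has_field_derivative_def]]
    by (simp add: o_def)
  then show "pdx (\<lambda>w. g (F w)) w = d * pdx F w" "pdy (\<lambda>w. g (F w)) w = d * pdy F w"
    "(\<lambda>w. g (F w)) differentiable (at w)"
    by (auto simp: pdx_eqI pdy_eqI differentiable_def)
qed

text \<open>The rule raises the order by one, given the composite with the derivative at the
  previous order. It is thus made for inductions in which derivatives reproduce the functions:
  \<open>sinh\<close> and \<open>cosh\<close> jointly, and \<open>inverse\<close>, whose derivative
  is minus its square.\<close>

lemma Ck_on_chain_real:
  fixes g g' :: "real \<Rightarrow> real"
  assumes U: "open U" and F: "Ck_on (Suc k) U F"
    and g: "\<And>w. w \<in> U \<Longrightarrow> DERIV g (F w) :> g' (F w)" and g': "Ck_on k U (\<lambda>w. g' (F w))"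
  shows "Ck_on (Suc k) U (\<lambda>w. g (F w))"
proof -
  have F': "F differentiable (at w)" if "w \<in> U" for w using F that by simp
  have "Ck_on k U (pdx (\<lambda>w. g (F w))) \<longleftrightarrow> Ck_on k U (\<lambda>w. g' (F w) * pdx F w)"
    "Ck_on k U (pdy (\<lambda>w. g (F w))) \<longleftrightarrow> Ck_on k U (\<lambda>w. g' (F w) * pdy F w)"
    by (auto intro!: Ck_on_cong[OF U] pdx_chain pdy_chain g F')
  then show ?thesis
    using F Ck_on_bilinear[OF U bounded_bilinear_mult g'] differentiable_chain_real[OF g F'] by auto
qed

lemma Ck_on_sinh_cosh:
  assumes U: "open U" and F: "Ck_on k U F"
  shows "Ck_on k U (\<lambda>w. sinh (F w :: real))" "Ck_on k U (\<lambda>w. cosh (F w))"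
proof -
  have "Ck_on k U (\<lambda>w. sinh (F w)) \<and> Ck_on k U (\<lambda>w. cosh (F w))"
    using F
  proof (induction k)
    case 0
    then show ?case by (auto intro!: continuous_intros)
  next
    case (Suc k)
    then show ?case
      using Ck_on_Suc_imp[OF Suc.prems]
      by (intro conjI Ck_on_chain_real[OF U Suc.prems, where g' = cosh]
          Ck_on_chain_real[OF U Suc.prems, where g' = sinh]) (auto intro!: derivative_eq_intros)
  qed
  then show "Ck_on k U (\<lambda>w. sinh (F w))" "Ck_on k U (\<lambda>w. cosh (F w))" by auto
qed

lemma Ck_on_inverse:
  fixes F :: "complex \<Rightarrow> real"
  assumes U: "open U" and F: "Ck_on k U F" and nz: "\<And>w. w \<in> U \<Longrightarrow> F w \<noteq> 0"
  shows "Ck_on k U (\<lambda>w. inverse (F w))"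
  using F
proof (induction k)
  case 0
  then show ?case using nz by (auto intro!: continuous_intros)
next
  case (Suc k)
  have 1: "Ck_on k U (\<lambda>w. inverse (F w))"
    using Suc.IH Ck_on_Suc_imp[OF Suc.prems] by blast
  have "Ck_on k U (\<lambda>w. - (inverse (F w) * inverse (F w)))"
    using Ck_on_linear[OF U bounded_linear_minus[OF bounded_linear_ident]
        Ck_on_bilinear[OF U bounded_bilinear_mult 1 1]] by simp
  then show ?case
    using nz by (intro Ck_on_chain_real[OF U Suc.prems, where g' = "\<lambda>x. - (inverse x * inverse x)"])
      (auto intro!: derivative_eq_intros)
qed

text \<open>Bootstrapping: the partial derivatives of \<open>\<Phi>\<close> are its products with
  \<open>P\<close> and \<open>Q\<close>, hence as regular as \<open>\<Phi>\<close> itself, and each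
  order yields the next.\<close>

lemma Ck_on_integral_curve:
  assumes U: "open U" and p: "bounded_bilinear p"
    and \<Phi>: "\<And>w. w \<in> U \<Longrightarrow> (\<Phi> has_derivative (\<lambda>k. p (one_form P Q w k) (\<Phi> w))) (at w)"
    and P: "\<And>k. Ck_on k U P" and Q: "\<And>k. Ck_on k U Q"
  shows "Ck_on k U \<Phi>"
proof (induction k)
  case 0
  then show ?case
    using \<Phi> by (auto intro!: continuous_at_imp_continuous_on has_derivative_continuous)
next
  case (Suc k)
  have "Ck_on k U (pdx \<Phi>) \<longleftrightarrow> Ck_on k U (\<lambda>w. p (P w) (\<Phi> w))"
    "Ck_on k U (pdy \<Phi>) \<longleftrightarrow> Ck_on k U (\<lambda>w. p (Q w) (\<Phi> w))"
    using pdx_eqI[OF \<Phi>] pdy_eqI[OF \<Phi>]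
    by (auto intro!: Ck_on_cong[OF U] simp: one_form_def)
  then show ?case
    using \<Phi> Ck_on_bilinear[OF U p P Suc.IH] Ck_on_bilinear[OF U p Q Suc.IH]
    by (auto simp: differentiable_def)
qed

section \<open>The connection of the orthonormal frame\<close>

lemma vector_4 [simp]:
  "(vector [a, b, c, d] :: 'a::zero ^ 4) $ 1 = a"
  "(vector [a, b, c, d] :: 'a::zero ^ 4) $ 2 = b"
  "(vector [a, b, c, d] :: 'a::zero ^ 4) $ 3 = c"
  "(vector [a, b, c, d] :: 'a::zero ^ 4) $ 4 = d"
  unfolding vector_def by simp_all

lemma bounded_bilinear_matrix_mult:
  "bounded_bilinear ((**) :: real ^ 'n ^ 'm \<Rightarrow> real ^ 'k ^ 'n \<Rightarrow> real ^ 'k ^ 'm)"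
  unfolding bilinear_conv_bounded_bilinear[symmetric] bilinear_def
  by (auto intro!: linearI simp: matrix_add_ldistrib matrix_matrix_mult_def vec_eq_iff sum.distrib
      sum_distrib_left algebra_simps)

lemma bounded_linear_transpose: "bounded_linear (transpose :: real ^ 'n ^ 'm \<Rightarrow> real ^ 'm ^ 'n)"
  by (intro linear_conv_bounded_linear[THEN iffD1] linearI) (auto simp: transpose_def vec_eq_iff)

lemma bounded_linear_axis: "bounded_linear (axis i :: 'a::euclidean_space \<Rightarrow> 'a ^ 'n)"
  by (intro linear_conv_bounded_linear[THEN iffD1] linearI) (auto simp: axis_def vec_eq_iff)

lemma has_derivative_vec_componentwise:
  fixes f :: "'b::real_normed_vector \<Rightarrow> 'a::euclidean_space ^ 'n"
  assumes "\<And>i. ((\<lambda>x. f x $ i) has_derivative (\<lambda>k. D k $ i)) F"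
  shows "(f has_derivative D) F"
proof -
  have e: "(\<Sum>i\<in>UNIV. axis i (v $ i)) = v" for v :: "'a ^ 'n"
    by (simp add: vec_eq_iff axis_def if_distrib cong: if_cong)
  have "((\<lambda>x. \<Sum>i\<in>UNIV. axis i (f x $ i)) has_derivative (\<lambda>k. \<Sum>i\<in>UNIV. axis i (D k $ i))) F"
    by (intro has_derivative_sum bounded_linear.has_derivative[OF bounded_linear_axis] assms)
  then show ?thesis by (simp add: e)
qed

lemma inner_matrix_mult_transpose: "(A ** transpose B) $ i $ j = A $ i \<bullet> (B $ j :: real ^ 'n)"
  by (simp add: matrix_matrix_mult_def transpose_def inner_vec_def)

lemma row_matrix_mult_4: "((A :: real ^ 4 ^ 'm) ** B) $ i =
    A $ i $ 1 *\<^sub>R B $ 1 + A $ i $ 2 *\<^sub>R B $ 2 + A $ i $ 3 *\<^sub>R B $ 3 + A $ i $ 4 *\<^sub>R B $ 4"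
  by (simp add: vec_eq_iff matrix_matrix_mult_def sum_4)

lemma inner_rows_orthogonal:
  fixes A :: "real ^ 'n ^ 'n"
  assumes "orthogonal_matrix A"
  shows "A $ i \<bullet> A $ j = (if i = j then 1 else 0)"
  using inner_matrix_mult_transpose[of A A i j] assms by (simp add: orthogonal_matrix_def mat_def)

lemma orthogonal_matrixI_inner:
  fixes A :: "real ^ 'n ^ 'n"
  assumes "\<And>i j. A $ i \<bullet> A $ j = (if i = j then 1 else 0)"
  shows "orthogonal_matrix A"
proof -
  have "A ** transpose A = mat 1"
    unfolding vec_eq_iff inner_matrix_mult_transpose assms by (simp add: mat_def)
  then show ?thesis
    unfolding orthogonal_matrix by (rule matrix_left_right_inverse[THEN iffD1])
qed

lemma vec_eq_4: "(x :: 'a ^ 4) = y \<longleftrightarrow> x $ 1 = y $ 1 \<and> x $ 2 = y $ 2 \<and> x $ 3 = y $ 3 \<and> x $ 4 = y $ 4"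
  by (simp add: vec_eq_iff forall_4)

lemma prod_4: "prod f (UNIV :: 4 set) = f 1 * f 2 * f 3 * f 4"
  unfolding UNIV_4 by (simp add: ac_simps)

text \<open>Multiplication from the left by the diagonal matrix with entries 1, s, t, 1. It carries
  the orientation condition between the coordinate frame and the normalized frame.\<close>

lemma det_scale_middle_rows:
  "det (vector [a, s *\<^sub>R b, t *\<^sub>R c, d] :: real ^ 4 ^ 4) = s * t * det (vector [a, b, c, d] :: real ^ 4 ^ 4)"
proof -
  define D :: "real ^ 4 ^ 4" where "D = (\<chi> i j. if i = j then (vector [1, s, t, 1] :: real ^ 4) $ i else 0)"
  have "(D ** vector [a, b, c, d]) $ i = (vector [a, s *\<^sub>R b, t *\<^sub>R c, d] :: real ^ 4 ^ 4) $ i" for i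
    using exhaust_4[of i] unfolding row_matrix_mult_4 by (auto simp: D_def)
  then have "D ** vector [a, b, c, d] = (vector [a, s *\<^sub>R b, t *\<^sub>R c, d] :: real ^ 4 ^ 4)"
    by (simp add: vec_eq_iff)
  moreover have "det D = s * t"
    by (subst det_diagonal) (simp_all add: D_def prod_4)
  ultimately show ?thesis using det_mul[of D "vector [a, b, c, d]"] by simp
qed

lemma differentiable_det:
  fixes A :: "'a::real_normed_vector \<Rightarrow> real ^ 'n ^ 'n"
  assumes "\<And>i. (\<lambda>x. A x $ i) differentiable (at y within T)"
  shows "(\<lambda>x. det (A x)) differentiable (at y within T)"
proof -
  have "\<exists>D. ((\<lambda>x. A x $ i) has_derivative D) (at y within T)" for i
    using assms by (simp add: differentiable_def)
  then obtain D where D: "\<And>i. ((\<lambda>x. A x $ i) has_derivative D i) (at y within T)" by metis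
  have d: "((\<lambda>x. A x $ i $ j) has_derivative (\<lambda>k. D i k $ j)) (at y within T)" for i j
    by (rule bounded_linear.has_derivative[OF bounded_linear_vec_nth D])
  have "(\<lambda>x. of_int (sign p) * (\<Prod>i\<in>UNIV. A x $ i $ p i)) differentiable (at y within T)" for p
    unfolding differentiable_def
    by (rule exI, rule has_derivative_mult_right, rule has_derivative_prod, rule d)
  then show ?thesis
    unfolding det_def by (intro differentiable_sum) auto
qed

text \<open>Cramer's rule: by orthogonality the k-th unit vector is the combination of the rows with
  the entries of column \<open>k\<close> as coefficients, and putting it in place of the last row
  multiplies the determinant by the last coefficient. Thus the last row is the generalized cross
  product of the other three, a polynomial in them.\<close>

lemma last_row_eq_det:
  fixes A :: "real ^ 4 ^ 4"
  assumes A: "orthogonal_matrix A" "det A = 1"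
  shows "A $ 4 $ k = det (vector [A $ 1, A $ 2, A $ 3, axis k 1] :: real ^ 4 ^ 4)"
proof -
  have "transpose A ** A = mat 1" using A by (simp add: orthogonal_matrix_def)
  then have "(\<Sum>i\<in>UNIV. A $ i $ k *s row i A) = axis k 1"
    by (auto simp: vec_eq_iff row_def matrix_matrix_mult_def transpose_def mat_def axis_def)
  then have "(\<chi> i. if i = 4 then \<Sum>i\<in>UNIV. (\<chi> i. A $ i $ k) $ i *s row i A else row i A) =
      (vector [A $ 1, A $ 2, A $ 3, axis k 1] :: real ^ 4 ^ 4)"
    by (simp add: vec_eq_4 row_def)
  then show ?thesis
    using cramer_lemma_transpose[of 4 "\<chi> i. A $ i $ k" A] A(2) by simp
qed

section \<open>The connection matrices and their flatness\<close>

text \<open>A skew matrix of size four has six free entries. The entry in the corner is fixed as 0,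
  because the derivatives of f are tangent to the surface and hence orthogonal to N.\<close>

definition skew :: "real \<Rightarrow> real \<Rightarrow> real \<Rightarrow> real \<Rightarrow> real \<Rightarrow> real ^ 4 ^ 4" where
  "skew a b c d e = vector [vector [0, a, b, 0], vector [- a, 0, c, d], vector [- b, - c, 0, e], vector [0, - d, - e, 0]]"

lemma skew_eq:
  "skew a b c d e = a *\<^sub>R skew 1 0 0 0 0 + b *\<^sub>R skew 0 1 0 0 0 + c *\<^sub>R skew 0 0 1 0 0
    + d *\<^sub>R skew 0 0 0 1 0 + e *\<^sub>R skew 0 0 0 0 1"
  by (simp add: vec_eq_4 skew_def)

lemma transpose_skew: "transpose (skew a b c d e) = - skew a b c d e"
  by (simp add: vec_eq_4 skew_def transpose_def)

lemma has_derivative_skew: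
  assumes "(a has_derivative a') F" "(b has_derivative b') F" "(c has_derivative c') F"
    "(d has_derivative d') F" "(e has_derivative e') F"
  shows "((\<lambda>x. skew (a x) (b x) (c x) (d x) (e x)) has_derivative
    (\<lambda>k. skew (a' k) (b' k) (c' k) (d' k) (e' k))) F"
  by (subst (1 2) skew_eq) (intro has_derivative_add has_derivative_scaleR_left assms)

lemma Ck_on_skew:
  assumes U: "open U" and "Ck_on k U a" "Ck_on k U b" "Ck_on k U c" "Ck_on k U d" "Ck_on k U e"
  shows "Ck_on k U (\<lambda>x. skew (a x) (b x) (c x) (d x) (e x))"
  by (subst skew_eq)
    (intro Ck_on_add[OF U] Ck_on_linear[OF U bounded_linear_scaleR_left] assms)

text \<open>
  The connection matrices of the orthonormal frame \<open>(f, f\<^sub>x / (2 sinh \<phi>), f\<^sub>y / (2 cosh \<phi>), N)\<close>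
  in the directions \<open>x\<close> and \<open>y\<close>; frame vectors are the rows.
\<close>

definition conn_x :: "(complex \<Rightarrow> real) \<Rightarrow> (complex \<Rightarrow> complex) \<Rightarrow> complex \<Rightarrow> real ^ 4 ^ 4" where
  "conn_x \<phi> \<mu> w = skew (2 * sinh (\<phi> w)) 0 (- pdy \<phi> w)
    (Re (\<mu> w) * inverse (sinh (\<phi> w))) (- Im (\<mu> w) * inverse (cosh (\<phi> w)))"

definition conn_y :: "(complex \<Rightarrow> real) \<Rightarrow> (complex \<Rightarrow> complex) \<Rightarrow> complex \<Rightarrow> real ^ 4 ^ 4" where
  "conn_y \<phi> \<mu> w = skew 0 (2 * cosh (\<phi> w)) (pdx \<phi> w)
    (- Im (\<mu> w) * inverse (sinh (\<phi> w))) (- Re (\<mu> w) * inverse (cosh (\<phi> w)))"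

lemma Ck_on_conn:
  assumes U: "open U" and \<phi>: "\<And>k. Ck_on k U \<phi>" and pos: "\<And>w. w \<in> U \<Longrightarrow> \<phi> w > 0"
    and \<mu>: "\<And>k. Ck_on k U \<mu>"
  shows "Ck_on k U (conn_x \<phi> \<mu>)" "Ck_on k U (conn_y \<phi> \<mu>)"
proof -
  have s: "Ck_on k U (\<lambda>w. sinh (\<phi> w))" and c: "Ck_on k U (\<lambda>w. cosh (\<phi> w))"
    using Ck_on_sinh_cosh[OF U \<phi>] by auto
  have iS: "Ck_on k U (\<lambda>w. inverse (sinh (\<phi> w)))" and iC: "Ck_on k U (\<lambda>w. inverse (cosh (\<phi> w)))"
    using pos by (intro Ck_on_inverse[OF U] s c; force)+
  have re: "Ck_on k U (\<lambda>w. Re (\<mu> w))" and im: "Ck_on k U (\<lambda>w. Im (\<mu> w))"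
    and nre: "Ck_on k U (\<lambda>w. - Re (\<mu> w))" and nim: "Ck_on k U (\<lambda>w. - Im (\<mu> w))"
    by (intro Ck_on_linear[OF U _ \<mu>] bounded_linear_minus bounded_linear_Re bounded_linear_Im)+
  have px: "Ck_on k U (pdx \<phi>)" "Ck_on k U (pdy \<phi>)"
    using \<phi>[of "Suc k"] by auto
  have npy: "Ck_on k U (\<lambda>w. - pdy \<phi> w)"
    by (intro Ck_on_linear[OF U _ px(2)] bounded_linear_minus bounded_linear_ident)
  note mul = Ck_on_bilinear[OF U bounded_bilinear_mult]
  show "Ck_on k U (conn_x \<phi> \<mu>)" "Ck_on k U (conn_y \<phi> \<mu>)"
    unfolding conn_x_def[abs_def] conn_y_def[abs_def]
    by (intro Ck_on_skew[OF U] mul Ck_on_const s c iS iC re im nre nim px npy)+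
qed

text \<open>Both sides are compared entry by entry. The first row holds identically; the entry (2,3)
  is the Gauss equation, and (2,4) and (3,4) are the imaginary and the real part of the Codazzi
  equation.\<close>

lemma conn_flat:
  assumes \<phi>: "Ck_on 2 U \<phi>" and \<mu>: "Ck_on 1 U \<mu>" and w: "w \<in> U" and pos: "\<phi> w > 0"
    and gauss: "pdx (pdx \<phi>) w + pdy (pdy \<phi>) w =
      2 * (- sinh (2 * \<phi> w) + (cmod (\<mu> w))\<^sup>2 / sinh (2 * \<phi> w))"
    and codazzi: "pdx \<mu> w + \<i> * pdy \<mu> w =
      - 4 * cnj (\<mu> w) * ((of_real (pdx \<phi> w) - \<i> * of_real (pdy \<phi> w)) / 2) / of_real (sinh (2 * \<phi> w))"
  shows "pdx (conn_y \<phi> \<mu>) w + conn_y \<phi> \<mu> w ** conn_x \<phi> \<mu> w =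
    pdy (conn_x \<phi> \<mu>) w + conn_x \<phi> \<mu> w ** conn_y \<phi> \<mu> w"
proof -
  define S where "S = sinh (\<phi> w)"
  define C where "C = cosh (\<phi> w)"
  have S: "S \<noteq> 0" and C: "C \<noteq> 0" using pos by (auto simp: S_def C_def)
  have inv: "inverse S * S = 1" "inverse C * C = 1" using S C by auto
  define a b where "a = inverse S" and "b = inverse C"
  have CS: "C * C = S * S + 1" unfolding C_def S_def using cosh_square_eq[of "\<phi> w"]
    by (simp add: power2_eq_square)
  \<comment> \<open>Forms of cosh^2 = sinh^2 + 1 in terms of the reciprocals \<open>a\<close> and
    \<open>b\<close>. They match the derivatives of 1 / sinh and 1 / cosh with the remaining terms,
    so that only polynomial identities are left.\<close>
  have k: "C * (a * a) = b + a * a * b" "S * (b * b) = a - a * (b * b)"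
    using inv CS unfolding a_def[symmetric] b_def[symmetric] by algebra+
  have dphi: "\<phi> differentiable (at w)" "pdx \<phi> differentiable (at w)" "pdy \<phi> differentiable (at w)"
    using \<phi> w by (auto simp: numeral_2_eq_2)
  have dmu: "\<mu> differentiable (at w)" using \<mu> w by simp
  note d\<phi> = has_derivative_pdx_pdy[OF dphi(1)]
  note d\<mu> = has_derivative_pdx_pdy[OF dmu]
  have chain: "((\<lambda>w. g (\<phi> w)) has_derivative (\<lambda>k. d * (Re k *\<^sub>R pdx \<phi> w + Im k *\<^sub>R pdy \<phi> w))) (at w)"
    if "DERIV g (\<phi> w) :> d" for g :: "real \<Rightarrow> real" and d
    using diff_chain_at[OF d\<phi> that[unfolded has_field_derivative_def]] by (simp add: o_def)
  have dS: "((\<lambda>w. sinh (\<phi> w)) has_derivative (\<lambda>k. C * (Re k *\<^sub>R pdx \<phi> w + Im k *\<^sub>R pdy \<phi> w))) (at w)"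
    and dC: "((\<lambda>w. cosh (\<phi> w)) has_derivative (\<lambda>k. S * (Re k *\<^sub>R pdx \<phi> w + Im k *\<^sub>R pdy \<phi> w))) (at w)"
    unfolding S_def C_def by (intro chain; auto intro!: derivative_eq_intros)+
  have dR: "((\<lambda>w. Re (\<mu> w)) has_derivative (\<lambda>k. Re (Re k *\<^sub>R pdx \<mu> w + Im k *\<^sub>R pdy \<mu> w))) (at w)"
    and dI: "((\<lambda>w. Im (\<mu> w)) has_derivative (\<lambda>k. Im (Re k *\<^sub>R pdx \<mu> w + Im k *\<^sub>R pdy \<mu> w))) (at w)"
    by (intro bounded_linear.has_derivative[OF bounded_linear_Re] bounded_linear.has_derivative[OF bounded_linear_Im] d\<mu>)+
  note iS = Deriv.has_derivative_inverse[OF S[unfolded S_def] dS]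
  note iC = Deriv.has_derivative_inverse[OF C[unfolded C_def] dC]
  have X: "pdx (conn_y \<phi> \<mu>) w = skew 0 (2 * (S * pdx \<phi> w)) (pdx (pdx \<phi>) w)
      (- Im (\<mu> w) * (- (inverse S * (C * pdx \<phi> w) * inverse S)) + - Im (pdx \<mu> w) * inverse S)
      (- Re (\<mu> w) * (- (inverse C * (S * pdx \<phi> w) * inverse C)) + - Re (pdx \<mu> w) * inverse C)"
    unfolding conn_y_def[abs_def]
    by (subst pdx_eqI[OF has_derivative_skew[OF has_derivative_const has_derivative_mult_right[OF dC]
            has_derivative_pdx_pdy[OF dphi(2)] has_derivative_mult[OF has_derivative_minus[OF dI] iS]
            has_derivative_mult[OF has_derivative_minus[OF dR] iC]]])
      (simp add: S_def C_def)
  have Y: "pdy (conn_x \<phi> \<mu>) w = skew (2 * (C * pdy \<phi> w)) 0 (- pdy (pdy \<phi>) w)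
      (Re (\<mu> w) * (- (inverse S * (C * pdy \<phi> w) * inverse S)) + Re (pdy \<mu> w) * inverse S)
      (- Im (\<mu> w) * (- (inverse C * (S * pdy \<phi> w) * inverse C)) + - Im (pdy \<mu> w) * inverse C)"
    unfolding conn_x_def[abs_def]
    by (subst pdy_eqI[OF has_derivative_skew[OF has_derivative_mult_right[OF dS] has_derivative_const
            has_derivative_minus[OF has_derivative_pdx_pdy[OF dphi(3)]] has_derivative_mult[OF dR iS]
            has_derivative_mult[OF has_derivative_minus[OF dI] iC]]])
      (simp add: S_def C_def)
  have s2: "sinh (2 * \<phi> w) = 2 * S * C" by (simp add: sinh_double S_def C_def)
  define p q p1 p2 q1 q2 f1 f2 f11 f22 where "p = Re (\<mu> w)" and "q = Im (\<mu> w)"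
    and "p1 = Re (pdx \<mu> w)" and "p2 = Re (pdy \<mu> w)" and "q1 = Im (pdx \<mu> w)" and "q2 = Im (pdy \<mu> w)"
    and "f1 = pdx \<phi> w" and "f2 = pdy \<phi> w" and "f11 = pdx (pdx \<phi>) w" and "f22 = pdy (pdy \<phi>) w"
  note defs = p_def[symmetric] q_def[symmetric] p1_def[symmetric] p2_def[symmetric]
    q1_def[symmetric] q2_def[symmetric] f1_def[symmetric] f2_def[symmetric] f11_def[symmetric] f22_def[symmetric]
  \<comment> \<open>Gauss and Codazzi are solved for one second derivative of \<phi> and for the
    x-derivatives of \<mu>, to be substituted into the entries.\<close>
  have g: "f11 = - f22 - 4 * S * C + (p * p + q * q) / (S * C)"
    using gauss S C unfolding s2 cmod_power2 defs
    by (simp add: field_simps power2_eq_square)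
  have "p1 - q2 = Re (pdx \<mu> w + \<i> * pdy \<mu> w)" "q1 + p2 = Im (pdx \<mu> w + \<i> * pdy \<mu> w)"
    by (simp_all add: p1_def p2_def q1_def q2_def)
  then have "p1 - q2 = - (p * f1 - q * f2) / (S * C)" "q1 + p2 = (q * f1 + p * f2) / (S * C)"
    unfolding codazzi s2 using S C
    by (simp_all add: defs Re_divide_of_real Im_divide_of_real field_simps)
  then have co: "p1 = q2 - (p * f1 - q * f2) / (S * C)" "q1 = - p2 + (q * f1 + p * f2) / (S * C)"
    unfolding minus_divide_left[symmetric] by linarith+
  show ?thesis
    unfolding X Y unfolding conn_x_def conn_y_def S_def[symmetric] C_def[symmetric] defs
    unfolding g co
    unfolding divide_inverse inverse_mult_distrib
    by (simp add: vec_eq_4 row_matrix_mult_4 skew_def S C)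
      (unfold a_def[symmetric] b_def[symmetric], intro conjI; (algebra | use k in algebra))
qed

section \<open>Moving frames: solutions with values in SO(4)\<close>

definition moving_frame :: "(complex \<Rightarrow> real) \<Rightarrow> (complex \<Rightarrow> complex) \<Rightarrow> complex set \<Rightarrow> (complex \<Rightarrow> real ^ 4 ^ 4) \<Rightarrow> bool" where
  "moving_frame \<phi> \<mu> U \<Phi> \<longleftrightarrow> (\<forall>w\<in>U. orthogonal_matrix (\<Phi> w) \<and> det (\<Phi> w) = 1 \<and>
    (\<Phi> has_derivative (\<lambda>k. one_form (conn_x \<phi> \<mu>) (conn_y \<phi> \<mu>) w k ** \<Phi> w)) (at w))"

lemma transpose_one_form_conn:
  "transpose (one_form (conn_x \<phi> \<mu>) (conn_y \<phi> \<mu>) w k) = - one_form (conn_x \<phi> \<mu>) (conn_y \<phi> \<mu>) w k"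
proof -
  interpret bounded_linear "transpose :: real ^ 4 ^ 4 \<Rightarrow> real ^ 4 ^ 4"
    by (rule bounded_linear_transpose)
  show ?thesis
    unfolding one_form_def conn_x_def conn_y_def by (simp add: add scaleR transpose_skew)
qed

lemma frame_product_constant:
  fixes \<Phi> \<Psi> :: "complex \<Rightarrow> real ^ 4 ^ 4"
  assumes U: "open U" "connected U"
    and \<Phi>: "\<And>w. w \<in> U \<Longrightarrow> (\<Phi> has_derivative (\<lambda>k. one_form (conn_x \<phi> \<mu>) (conn_y \<phi> \<mu>) w k ** \<Phi> w)) (at w)"
    and \<Psi>: "\<And>w. w \<in> U \<Longrightarrow> (\<Psi> has_derivative (\<lambda>k. one_form (conn_x \<phi> \<mu>) (conn_y \<phi> \<mu>) w k ** \<Psi> w)) (at w)"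
    and "w \<in> U" "v \<in> U"
  shows "transpose (\<Psi> w) ** \<Phi> w = transpose (\<Psi> v) ** \<Phi> v"
proof (rule has_derivative_zero_unique_connected[OF U _ assms(5,6)])
  fix w assume w: "w \<in> U"
  interpret m: bounded_bilinear "(**) :: real^4^4 \<Rightarrow> real^4^4 \<Rightarrow> real^4^4"
    by (rule bounded_bilinear_matrix_mult)
  show "((\<lambda>w. transpose (\<Psi> w) ** \<Phi> w) has_derivative (\<lambda>k. 0)) (at w)"
    by (rule has_derivative_eq_rhs[OF m.FDERIV[OF
            bounded_linear.has_derivative[OF bounded_linear_transpose \<Psi>[OF w]] \<Phi>[OF w]]])
      (simp add: matrix_transpose_mul transpose_one_form_conn m.minus_right m.minus_left matrix_mul_assoc)
qed

lemma moving_frame_exists: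
  assumes U: "open U" "simply_connected U" "U \<noteq> {}"
    and \<phi>: "\<And>k. Ck_on k U \<phi>"
      and pos: "\<And>w. w \<in> U \<Longrightarrow> \<phi> w > 0" and \<mu>: "\<And>k. Ck_on k U \<mu>"
    and gauss: "\<And>w. w \<in> U \<Longrightarrow> pdx (pdx \<phi>) w + pdy (pdy \<phi>) w =
      2 * (- sinh (2 * \<phi> w) + (cmod (\<mu> w))\<^sup>2 / sinh (2 * \<phi> w))"
    and codazzi: "\<And>w. w \<in> U \<Longrightarrow> pdx \<mu> w + \<i> * pdy \<mu> w =
      - 4 * cnj (\<mu> w) * ((of_real (pdx \<phi> w) - \<i> * of_real (pdy \<phi> w)) / 2) / of_real (sinh (2 * \<phi> w))"
  obtains \<Phi> where "moving_frame \<phi> \<mu> U \<Phi>" "\<forall>k. Ck_on k U \<Phi>"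
proof -
  let ?P = "conn_x \<phi> \<mu>" and ?Q = "conn_y \<phi> \<mu>"
  note C = Ck_on_conn[OF U(1) \<phi> pos \<mu>]
  have con: "connected U" using U(2) simply_connected_imp_connected by blast
  have flat: "pdx ?Q w ** v + ?Q w ** (?P w ** v) = pdy ?P w ** v + ?P w ** (?Q w ** v)"
    if "w \<in> U" for w and v :: "real ^ 4 ^ 4"
    using arg_cong[OF conn_flat[OF \<phi> \<mu> that pos[OF that] gauss[OF that] codazzi[OF that]], of "\<lambda>A. A ** v"]
    by (simp add: bounded_bilinear.add_left[OF bounded_bilinear_matrix_mult] matrix_mul_assoc)
  obtain w0 \<Phi> where w0: "w0 \<in> U" "\<Phi> w0 = (mat 1 :: real ^ 4 ^ 4)"
      and \<Phi>: "\<And>w. w \<in> U \<Longrightarrow> (\<Phi> has_derivative (\<lambda>k. one_form ?P ?Q w k ** \<Phi> w)) (at w)"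
    by (rule frobenius_simply_connected[OF bounded_bilinear_matrix_mult U C flat, of "mat 1"]) blast+
  have orth: "orthogonal_matrix (\<Phi> w)" if w: "w \<in> U" for w
  proof -
    have "transpose (\<Phi> w) ** \<Phi> w = transpose (\<Phi> w0) ** \<Phi> w0"
      by (rule frame_product_constant[where \<phi> = \<phi> and \<mu> = \<mu> and U = U]) (fact U(1) con \<Phi> w w0(1))+
    also have "\<dots> = mat 1"
      unfolding w0(2) transpose_mat matrix_mul_lid ..
    finally show ?thesis unfolding orthogonal_matrix .
  qed
  have "(\<lambda>w. det (\<Phi> w)) differentiable (at w)" if w: "w \<in> U" for w
  proof (rule differentiable_det)
    show "(\<lambda>w. \<Phi> w $ i) differentiable (at w)" for i
      by (rule differentiableI[OF bounded_linear.has_derivative[OF bounded_linear_vec_nth \<Phi>[OF w]]])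
  qed
  then have "continuous_on U (\<lambda>w. det (\<Phi> w))"
    by (intro continuous_at_imp_continuous_on ballI differentiable_imp_continuous_within)
  then have conD: "connected ((\<lambda>w. det (\<Phi> w)) ` U)"
    using con connected_continuous_image by blast
  \<comment> \<open>An orthogonal matrix has determinant 1 or -1. The value 1 is taken at
    \<open>w0\<close>, so by connectedness a value -1 would force the value 0 in between.\<close>
  have "det (\<Phi> w) = 1" if w: "w \<in> U" for w
  proof (rule ccontr)
    assume "det (\<Phi> w) \<noteq> 1"
    then have "det (\<Phi> w) = -1" using det_orthogonal_matrix[OF orth[OF w]] by blast
    moreover have "det (\<Phi> w0) = 1" by (simp add: w0)
    ultimately have "{-1..1} \<subseteq> (\<lambda>w. det (\<Phi> w)) ` U"
      using connected_contains_Icc[OF conD imageI[OF w] imageI[OF w0(1)]] by simp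
    then have "0 \<in> (\<lambda>w. det (\<Phi> w)) ` U" by (rule subsetD) simp
    then obtain v where "v \<in> U" "det (\<Phi> v) = 0" by auto
    then show False using det_orthogonal_matrix[OF orth[of v]] by simp
  qed
  then have "moving_frame \<phi> \<mu> U \<Phi>" using orth \<Phi> by (simp add: moving_frame_def)
  moreover have "Ck_on k U \<Phi>" for k
    by (rule Ck_on_integral_curve[OF U(1) bounded_bilinear_matrix_mult \<Phi> C])
  ultimately show ?thesis using that by blast
qed

section \<open>Maps with the prescribed data and their adapted frames\<close>

text \<open>Real form of \<open>harmonic_map_with_data\<close> for coordinate representations. The
  harmonic map equation becomes Laplacian G = - 4 cosh 2\<phi> G, since \<open>del\<close> and
  \<open>delbar\<close> of f have product cosh 2\<phi>, together with the symmetry of the mixed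
  derivatives as its imaginary part. Non-conformality is contained in the two lengths, whose squares
  differ by 4.\<close>

definition surface_data :: "complex set \<Rightarrow> (complex \<Rightarrow> real) \<Rightarrow> (complex \<Rightarrow> complex) \<Rightarrow>
    (complex \<Rightarrow> real ^ 4) \<Rightarrow> (complex \<Rightarrow> real ^ 4) \<Rightarrow> bool" where
  "surface_data U \<phi> \<mu> G n \<longleftrightarrow> (\<forall>k. Ck_on k U G) \<and> (\<forall>w\<in>U.
     G w \<bullet> G w = 1 \<and> G w \<bullet> pdx G w = 0 \<and> G w \<bullet> pdy G w = 0 \<and>
     pdx G w \<bullet> pdx G w = (2 * sinh (\<phi> w))\<^sup>2 \<and> pdy G w \<bullet> pdy G w = (2 * cosh (\<phi> w))\<^sup>2 \<and>
     pdx G w \<bullet> pdy G w = 0 \<and>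
     n w \<bullet> n w = 1 \<and> n w \<bullet> G w = 0 \<and> n w \<bullet> pdx G w = 0 \<and> n w \<bullet> pdy G w = 0 \<and>
     det (vector [G w, pdx G w, pdy G w, n w] :: real ^ 4 ^ 4) > 0 \<and>
     pdx (pdx G) w + pdy (pdy G) w = (- 4 * cosh (2 * \<phi> w)) *\<^sub>R G w \<and> pdx (pdy G) w = pdy (pdx G) w \<and>
     (pdx (pdx G) w - pdy (pdy G) w) \<bullet> n w = 4 * Re (\<mu> w) \<and> pdx (pdy G) w \<bullet> n w = - 2 * Im (\<mu> w))"

lemma surface_data_of_frame:
  assumes U: "open U" and \<phi>: "\<And>w. w \<in> U \<Longrightarrow> \<phi> differentiable (at w)"
    and pos: "\<And>w. w \<in> U \<Longrightarrow> \<phi> w > 0"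
    and \<Phi>: "moving_frame \<phi> \<mu> U \<Phi>" and Ck: "\<And>k. Ck_on k U \<Phi>"
  shows "surface_data U \<phi> \<mu> (\<lambda>w. \<Phi> w $ 1) (\<lambda>w. \<Phi> w $ 4)"
proof -
  let ?P = "conn_x \<phi> \<mu>" and ?Q = "conn_y \<phi> \<mu>"
  have d: "((\<lambda>w. \<Phi> w $ i) has_derivative (\<lambda>k. (one_form ?P ?Q w k ** \<Phi> w) $ i)) (at w)" if "w \<in> U" for w i
  proof (rule bounded_linear.has_derivative[OF bounded_linear_vec_nth])
    show "(\<Phi> has_derivative (\<lambda>k. one_form ?P ?Q w k ** \<Phi> w)) (at w)"
      using \<Phi> that unfolding moving_frame_def by blast
  qed
  have X: "pdx (\<lambda>w. \<Phi> w $ i) w = (?P w ** \<Phi> w) $ i"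
    and Y: "pdy (\<lambda>w. \<Phi> w $ i) w = (?Q w ** \<Phi> w) $ i"
    and df: "(\<lambda>w. \<Phi> w $ i) differentiable (at w)"
    if "w \<in> U" for w i
  proof -
    show "pdx (\<lambda>w. \<Phi> w $ i) w = (?P w ** \<Phi> w) $ i" "pdy (\<lambda>w. \<Phi> w $ i) w = (?Q w ** \<Phi> w) $ i"
      unfolding pdx_eqI[OF d[OF that]] pdy_eqI[OF d[OF that]] by (simp_all add: one_form_def)
    show "(\<lambda>w. \<Phi> w $ i) differentiable (at w)"
      by (rule differentiableI[OF d[OF that]])
  qed
  define G where "G w = \<Phi> w $ 1" for w
  have Gx: "pdx G w = (2 * sinh (\<phi> w)) *\<^sub>R \<Phi> w $ 2" and Gy: "pdy G w = (2 * cosh (\<phi> w)) *\<^sub>R \<Phi> w $ 3"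
    if "w \<in> U" for w
    using X[OF that, of 1] Y[OF that, of 1]
    by (simp_all add: G_def[abs_def] row_matrix_mult_4 conn_x_def conn_y_def skew_def)
  have sc: "DERIV (\<lambda>x. 2 * sinh x) x :> 2 * cosh x" "DERIV (\<lambda>x. 2 * cosh x) x :> 2 * sinh x" for x :: real
    by (auto intro!: derivative_eq_intros)
  note bl = bounded_bilinear_scaleR
  have "Ck_on k U G" for k unfolding G_def[abs_def]
    by (rule Ck_on_linear[OF U bounded_linear_vec_nth Ck])
  moreover have "G w \<bullet> G w = 1 \<and> G w \<bullet> pdx G w = 0 \<and> G w \<bullet> pdy G w = 0 \<and>
     pdx G w \<bullet> pdx G w = (2 * sinh (\<phi> w))\<^sup>2 \<and> pdy G w \<bullet> pdy G w = (2 * cosh (\<phi> w))\<^sup>2 \<and>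
     pdx G w \<bullet> pdy G w = 0 \<and>
     \<Phi> w $ 4 \<bullet> \<Phi> w $ 4 = 1 \<and> \<Phi> w $ 4 \<bullet> G w = 0 \<and> \<Phi> w $ 4 \<bullet> pdx G w = 0 \<and> \<Phi> w $ 4 \<bullet> pdy G w = 0 \<and>
     det (vector [G w, pdx G w, pdy G w, \<Phi> w $ 4] :: real ^ 4 ^ 4) > 0 \<and>
     pdx (pdx G) w + pdy (pdy G) w = (- 4 * cosh (2 * \<phi> w)) *\<^sub>R G w \<and> pdx (pdy G) w = pdy (pdx G) w \<and>
     (pdx (pdx G) w - pdy (pdy G) w) \<bullet> \<Phi> w $ 4 = 4 * Re (\<mu> w) \<and>
     pdx (pdy G) w \<bullet> \<Phi> w $ 4 = - 2 * Im (\<mu> w)" if w: "w \<in> U" for w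
  proof -
    have o: "orthogonal_matrix (\<Phi> w)" "det (\<Phi> w) = 1" using \<Phi> w
      by (auto simp: moving_frame_def)
    note in_rows = inner_rows_orthogonal[OF o(1)]
    have S: "sinh (\<phi> w) \<noteq> 0" "sinh (\<phi> w) > 0" and C: "cosh (\<phi> w) \<noteq> 0" using pos[OF w] by auto
    note p\<phi> = pdx_chain[OF sc(1) \<phi>[OF w]] pdx_chain[OF sc(2) \<phi>[OF w]]
      pdy_chain[OF sc(1) \<phi>[OF w]] pdy_chain[OF sc(2) \<phi>[OF w]]
      differentiable_chain_real[OF sc(1) \<phi>[OF w]] differentiable_chain_real[OF sc(2) \<phi>[OF w]]
    have rows: "\<Phi> w = vector [\<Phi> w $ 1, \<Phi> w $ 2, \<Phi> w $ 3, \<Phi> w $ 4]"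
      unfolding vec_eq_iff[of "\<Phi> w"] by (simp add: forall_4)
    have cong: "pdx (pdx G) w = pdx (\<lambda>w. (2 * sinh (\<phi> w)) *\<^sub>R \<Phi> w $ 2) w"
      "pdy (pdx G) w = pdy (\<lambda>w. (2 * sinh (\<phi> w)) *\<^sub>R \<Phi> w $ 2) w"
      "pdx (pdy G) w = pdx (\<lambda>w. (2 * cosh (\<phi> w)) *\<^sub>R \<Phi> w $ 3) w"
      "pdy (pdy G) w = pdy (\<lambda>w. (2 * cosh (\<phi> w)) *\<^sub>R \<Phi> w $ 3) w"
      by (rule pdx_cong[OF U w Gx] pdy_cong[OF U w Gx] pdx_cong[OF U w Gy] pdy_cong[OF U w Gy], assumption)+
    have xx: "pdx (pdx G) w = (2 * sinh (\<phi> w)) *\<^sub>R (?P w ** \<Phi> w) $ 2 + (2 * cosh (\<phi> w) * pdx \<phi> w) *\<^sub>R \<Phi> w $ 2"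
      unfolding cong pdx_bilinear[OF bl p\<phi>(5) df[OF w]] p\<phi>(1) X[OF w] by (rule refl)
    have xy: "pdy (pdx G) w = (2 * sinh (\<phi> w)) *\<^sub>R (?Q w ** \<Phi> w) $ 2 + (2 * cosh (\<phi> w) * pdy \<phi> w) *\<^sub>R \<Phi> w $ 2"
      unfolding cong pdy_bilinear[OF bl p\<phi>(5) df[OF w]] p\<phi>(3) Y[OF w] by (rule refl)
    have yx: "pdx (pdy G) w = (2 * cosh (\<phi> w)) *\<^sub>R (?P w ** \<Phi> w) $ 3 + (2 * sinh (\<phi> w) * pdx \<phi> w) *\<^sub>R \<Phi> w $ 3"
      unfolding cong pdx_bilinear[OF bl p\<phi>(6) df[OF w]] p\<phi>(2) X[OF w] by (rule refl)
    have yy: "pdy (pdy G) w = (2 * cosh (\<phi> w)) *\<^sub>R (?Q w ** \<Phi> w) $ 3 + (2 * sinh (\<phi> w) * pdy \<phi> w) *\<^sub>R \<Phi> w $ 3"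
      unfolding cong pdy_bilinear[OF bl p\<phi>(6) df[OF w]] p\<phi>(4) Y[OF w] by (rule refl)
    note second = xx[unfolded row_matrix_mult_4 conn_x_def skew_def]
      xy[unfolded row_matrix_mult_4 conn_y_def skew_def] yx[unfolded row_matrix_mult_4 conn_x_def skew_def]
      yy[unfolded row_matrix_mult_4 conn_y_def skew_def]
    \<comment> \<open>In the sum of f_xx and f_yy the tangential parts and the normal parts cancel,
      and the coefficients of f add up to -4 (sinh^2 + cosh^2). The mixed derivatives agree because
      each off-diagonal entry of the connection was weighted by the matching length.\<close>
    have lap: "pdx (pdx G) w + pdy (pdy G) w = (- 4 * cosh (2 * \<phi> w)) *\<^sub>R G w"
      "pdx (pdy G) w = pdy (pdx G) w"
      unfolding second cosh_double
        by (use S C in \<open>simp_all add: G_def algebra_simps power2_eq_square scaleR_add_left[symmetric]\<close>)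
    have nn: "(pdx (pdx G) w - pdy (pdy G) w) \<bullet> \<Phi> w $ 4 = 4 * Re (\<mu> w)"
      "pdx (pdy G) w \<bullet> \<Phi> w $ 4 = - 2 * Im (\<mu> w)"
      unfolding second using S C by (simp_all add: inner_diff_left inner_add_left in_rows)
        (simp_all add: field_simps)
    have "det (vector [G w, pdx G w, pdy G w, \<Phi> w $ 4] :: real ^ 4 ^ 4) > 0"
      unfolding Gx[OF w] Gy[OF w] det_scale_middle_rows G_def rows[symmetric] using o(2) S by simp
    then show ?thesis
      using lap nn by (simp add: Gx[OF w] Gy[OF w] in_rows power2_eq_square) (simp add: G_def in_rows)
  qed
  ultimately show ?thesis unfolding surface_data_def G_def[abs_def] by blast
qed

lemma orthonormal_expansion_4:
  fixes A :: "real ^ 4 ^ 4"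
  assumes "orthogonal_matrix A"
  shows "x = (x \<bullet> A $ 1) *\<^sub>R A $ 1 + (x \<bullet> A $ 2) *\<^sub>R A $ 2 + (x \<bullet> A $ 3) *\<^sub>R A $ 3 + (x \<bullet> A $ 4) *\<^sub>R A $ 4"
proof -
  have "transpose A *v (A *v x) = x"
    using assms unfolding matrix_vector_mul_assoc orthogonal_matrix_def by simp
  moreover have ax: "(A *v x) $ i = x \<bullet> A $ i" for i
    by (simp add: matrix_vector_mult_def inner_vec_def mult.commute)
  have "transpose A *v (A *v x) = (\<chi> j. \<Sum>i\<in>UNIV. A $ i $ j * (x \<bullet> A $ i))"
    unfolding matrix_vector_mult_def[of "transpose A"] ax by (simp add: transpose_def)
  ultimately have eq: "x = (\<chi> j. \<Sum>i\<in>UNIV. A $ i $ j * (x \<bullet> A $ i))" by (rule subst)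
  have xj: "x $ j = (\<Sum>i\<in>UNIV. A $ i $ j * (x \<bullet> A $ i))" for j
    using arg_cong[OF eq, of "\<lambda>v. v $ j"] by (simp only: vec_lambda_beta)
  show ?thesis
    unfolding vec_eq_iff[of x] xj sum_4 by (simp add: mult.commute)
qed

lemma moving_frames_congruent:
  assumes U: "open U" "connected U" and "w0 \<in> U"
    and \<Phi>: "moving_frame \<phi> \<mu> U \<Phi>" and \<Psi>: "moving_frame \<phi> \<mu> U \<Psi>"
  obtains R :: "real ^ 4 ^ 4" where "orthogonal_matrix R" "\<forall>w\<in>U. \<Psi> w $ 1 = R *v (\<Phi> w $ 1)"
proof
  let ?R = "transpose (\<Psi> w0) ** \<Phi> w0"
  show "orthogonal_matrix ?R"
    using \<Phi> \<Psi> \<open>w0 \<in> U\<close> unfolding moving_frame_def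
    by (intro orthogonal_matrix_mul) (auto simp: orthogonal_matrix_def)
  show "\<forall>w\<in>U. \<Psi> w $ 1 = ?R *v (\<Phi> w $ 1)"
  proof
    fix w assume w: "w \<in> U"
    have o: "orthogonal_matrix (\<Phi> w)" using \<Phi> w by (simp add: moving_frame_def)
    have "transpose (\<Psi> w) ** \<Phi> w = ?R"
      by (rule frame_product_constant[where \<phi> = \<phi> and \<mu> = \<mu> and U = U])
        (use U \<Phi> \<Psi> w \<open>w0 \<in> U\<close> in \<open>auto simp: moving_frame_def\<close>)
    \<comment> \<open>The rows of \<open>\<Phi> w\<close> are orthonormal, so it sends its own first
      row to the first unit vector, and the transpose of \<open>\<Psi> w\<close> sends that vector
      to the first row of \<open>\<Psi> w\<close>. The constant matrix therefore maps one surface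
      onto the other.\<close>
    moreover have "\<Phi> w *v (\<Phi> w $ 1) = axis 1 1"
      using inner_rows_orthogonal[OF o]
      by (auto simp: vec_eq_iff matrix_vector_mult_def axis_def inner_vec_def)
    moreover have "transpose (\<Psi> w) *v axis 1 1 = \<Psi> w $ 1"
      by (simp add: vec_eq_iff matrix_vector_mult_def transpose_def axis_def if_distrib cong: if_cong)
    ultimately show "\<Psi> w $ 1 = ?R *v (\<Phi> w $ 1)"
      using matrix_vector_mul_assoc[of "transpose (\<Psi> w)" "\<Phi> w" "\<Phi> w $ 1"] by simp
  qed
qed

text \<open>Every connection entry is forced by the data: skewness and the definition of the frame
  give the first row, the symmetry of the mixed derivatives the rotation in the tangent plane, and
  \<mu> with the Laplace equation the normal components. Hence any two maps with the same data have
  frames solving the same system.\<close>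

lemma moving_frame_of_surface_data:
  assumes U: "open U" and \<phi>: "\<And>w. w \<in> U \<Longrightarrow> \<phi> differentiable (at w)"
    and pos: "\<And>w. w \<in> U \<Longrightarrow> \<phi> w > 0"
    and data: "surface_data U \<phi> \<mu> G n"
  obtains \<Phi> where "moving_frame \<phi> \<mu> U \<Phi>" "\<forall>w. \<Phi> w $ 1 = G w"
proof -
  define e1 where "e1 w = inverse (2 * sinh (\<phi> w)) *\<^sub>R pdx G w" for w
  define e2 where "e2 w = inverse (2 * cosh (\<phi> w)) *\<^sub>R pdy G w" for w
  define \<Phi> :: "complex \<Rightarrow> real ^ 4 ^ 4" where "\<Phi> w = vector [G w, e1 w, e2 w, n w]" for w
  have S: "sinh (\<phi> w) > 0" "sinh (\<phi> w) \<noteq> 0" and C: "cosh (\<phi> w) > 0" "cosh (\<phi> w) \<noteq> 0" if "w \<in> U" for w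
    using pos[OF that] by auto
  have Gx: "pdx G w = (2 * sinh (\<phi> w)) *\<^sub>R e1 w"
    and Gy: "pdy G w = (2 * cosh (\<phi> w)) *\<^sub>R e2 w" if "w \<in> U" for w
    using S[OF that] C[OF that] by (simp_all add: e1_def e2_def)
  note data' = data[unfolded surface_data_def, THEN conjunct2, rule_format]
  have CkG: "Ck_on k U G" for k using data by (simp add: surface_data_def)
  have o: "orthogonal_matrix (\<Phi> w)" if w: "w \<in> U" for w
  proof (rule orthogonal_matrixI_inner)
    note d = data'[OF w]
    have "e1 w \<bullet> e1 w = 1" "e2 w \<bullet> e2 w = 1" "e1 w \<bullet> e2 w = 0"
      using d S[OF w] C[OF w] by (simp_all add: e1_def e2_def power2_eq_square)
    moreover have "G w \<bullet> e1 w = 0" "G w \<bullet> e2 w = 0" "n w \<bullet> e1 w = 0" "n w \<bullet> e2 w = 0"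
      using d by (simp_all add: e1_def e2_def)
    ultimately have "\<forall>i j. \<Phi> w $ i \<bullet> \<Phi> w $ j = (if i = j then 1 else 0)"
      using d unfolding forall_4 \<Phi>_def by (simp add: inner_commute)
    then show "\<Phi> w $ i \<bullet> \<Phi> w $ j = (if i = j then 1 else 0)" for i j by blast
  qed
  have det: "det (\<Phi> w) = 1" if w: "w \<in> U" for w
  proof -
    have "det (\<Phi> w) > 0"
      using data'[OF w] S(1)[OF w] C(1)[OF w]
      unfolding \<Phi>_def e1_def e2_def det_scale_middle_rows by simp
    then show ?thesis using det_orthogonal_matrix[OF o[OF w]] by auto
  qed
  have sc: "DERIV (\<lambda>x. 2 * sinh x) x :> 2 * cosh x" "DERIV (\<lambda>x. 2 * cosh x) x :> 2 * sinh x" for x :: real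
    by (auto intro!: derivative_eq_intros)
  have isc: "DERIV (\<lambda>x. inverse (2 * sinh x)) (\<phi> w) :>
      - (inverse (2 * sinh (\<phi> w)) * (2 * cosh (\<phi> w)) * inverse (2 * sinh (\<phi> w)))"
    "DERIV (\<lambda>x. inverse (2 * cosh x)) (\<phi> w) :>
      - (inverse (2 * cosh (\<phi> w)) * (2 * sinh (\<phi> w)) * inverse (2 * cosh (\<phi> w)))"
    if w: "w \<in> U" for w
  proof -
    have "2 * sinh (\<phi> w) \<noteq> 0" "2 * cosh (\<phi> w) \<noteq> 0" using S(2)[OF w] C(2)[OF w] by simp_all
    from DERIV_inverse'[OF sc(1) this(1)] DERIV_inverse'[OF sc(2) this(2)]
    show "DERIV (\<lambda>x. inverse (2 * sinh x)) (\<phi> w) :>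
        - (inverse (2 * sinh (\<phi> w)) * (2 * cosh (\<phi> w)) * inverse (2 * sinh (\<phi> w)))"
      "DERIV (\<lambda>x. inverse (2 * cosh x)) (\<phi> w) :>
        - (inverse (2 * cosh (\<phi> w)) * (2 * sinh (\<phi> w)) * inverse (2 * cosh (\<phi> w)))" .
  qed
  note bl = bounded_bilinear_scaleR
  have dG: "G differentiable (at w)" "pdx G differentiable (at w)" "pdy G differentiable (at w)" if "w \<in> U" for w
    using CkG[of "Suc (Suc 0)"] that by auto
  have d123: "G differentiable (at w)" "e1 differentiable (at w)" "e2 differentiable (at w)" if w: "w \<in> U" for w
  proof -
    show "G differentiable (at w)" by (rule dG[OF w])
    show "e1 differentiable (at w)" "e2 differentiable (at w)"
      unfolding e1_def[abs_def] e2_def[abs_def]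
      by (rule differentiable_bilinear[OF bl differentiable_chain_real[OF isc(1)[OF w] \<phi>[OF w]] dG(2)[OF w]]
          differentiable_bilinear[OF bl differentiable_chain_real[OF isc(2)[OF w] \<phi>[OF w]] dG(3)[OF w]])+
  qed
  \<comment> \<open>Nothing is assumed about the regularity of \<open>n\<close>; it is inherited from the other three rows.\<close>
  have dn: "n differentiable (at w)" if w: "w \<in> U" for w
  proof -
    have "(\<lambda>v. n v $ k) differentiable (at w)" for k
    proof -
      have "(\<lambda>v. det (vector [G v, e1 v, e2 v, axis k 1] :: real ^ 4 ^ 4)) differentiable (at w)"
      proof (rule differentiable_det)
        have "\<forall>i. (\<lambda>v. (vector [G v, e1 v, e2 v, axis k 1] :: real ^ 4 ^ 4) $ i) differentiable (at w)"
          unfolding forall_4 using d123[OF w] by simp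
        then show "(\<lambda>v. (vector [G v, e1 v, e2 v, axis k 1] :: real ^ 4 ^ 4) $ i) differentiable (at w)" for i
          by blast
      qed
      moreover have eq: "det (vector [G v, e1 v, e2 v, axis k 1] :: real ^ 4 ^ 4) = n v $ k" if "v \<in> U" for v
        using last_row_eq_det[OF o[OF that] det[OF that], of k] by (simp add: \<Phi>_def)
      ultimately show ?thesis
        by (simp only: differentiable_cong_open[OF U w eq])
    qed
    then have "((\<lambda>v. n v $ k) has_derivative frechet_derivative (\<lambda>v. n v $ k) (at w)) (at w)" for k
      by (simp only: frechet_derivative_works[symmetric])
    then have "(n has_derivative (\<lambda>h. \<chi> k. frechet_derivative (\<lambda>v. n v $ k) (at w) h)) (at w)"
      by (intro has_derivative_vec_componentwise) (simp only: vec_lambda_beta)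
    then show ?thesis by (rule differentiableI)
  qed
  have d\<Phi>: "(\<lambda>v. \<Phi> v $ i) differentiable (at w)" if w: "w \<in> U" for w i
  proof -
    have "\<forall>i. (\<lambda>v. \<Phi> v $ i) differentiable (at w)"
      unfolding forall_4 \<Phi>_def using d123[OF w] dn[OF w] by simp
    then show ?thesis by blast
  qed
  have "(\<Phi> has_derivative (\<lambda>k. one_form (conn_x \<phi> \<mu>) (conn_y \<phi> \<mu>) w k ** \<Phi> w)) (at w)" if w: "w \<in> U" for w
  proof -
    define X where "X i = pdx (\<lambda>v. \<Phi> v $ i) w" for i
    define Y where "Y i = pdy (\<lambda>v. \<Phi> v $ i) w" for i
    note in_rows = inner_rows_orthogonal[OF o[OF w]]
    \<comment> \<open>Differentiation of the constant inner products between the rows.\<close>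
    have skX: "X j \<bullet> \<Phi> w $ i = - (X i \<bullet> \<Phi> w $ j)"
      and skY: "Y j \<bullet> \<Phi> w $ i = - (Y i \<bullet> \<Phi> w $ j)" for i j
    proof -
      have "\<Phi> v $ i \<bullet> \<Phi> v $ j = (if i = j then 1 else 0)" if "v \<in> U" for v
        by (rule inner_rows_orthogonal[OF o[OF that]])
      note c = pdx_cong[OF U w this] pdy_cong[OF U w this]
      have "pdx (\<lambda>v. \<Phi> v $ i \<bullet> \<Phi> v $ j) w = 0" "pdy (\<lambda>v. \<Phi> v $ i \<bullet> \<Phi> v $ j) w = 0"
        using c pdx_eqI[OF has_derivative_const] pdy_eqI[OF has_derivative_const] by auto
      then show "X j \<bullet> \<Phi> w $ i = - (X i \<bullet> \<Phi> w $ j)" "Y j \<bullet> \<Phi> w $ i = - (Y i \<bullet> \<Phi> w $ j)"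
        unfolding pdx_bilinear[OF bounded_bilinear_inner d\<Phi>[OF w] d\<Phi>[OF w]]
          pdy_bilinear[OF bounded_bilinear_inner d\<Phi>[OF w] d\<Phi>[OF w]] X_def[symmetric] Y_def[symmetric]
        by (simp_all add: inner_commute)
    qed
    have rows: "(\<lambda>v. \<Phi> v $ 1) = G" "(\<lambda>v. \<Phi> v $ 2) = e1" "(\<lambda>v. \<Phi> v $ 3) = e2" "(\<lambda>v. \<Phi> v $ 4) = n"
      by (simp_all add: \<Phi>_def)
    have rw: "\<Phi> w $ 1 = G w" "\<Phi> w $ 2 = e1 w" "\<Phi> w $ 3 = e2 w" "\<Phi> w $ 4 = n w"
      by (simp_all add: \<Phi>_def)
    have XY1: "X 1 = (2 * sinh (\<phi> w)) *\<^sub>R e1 w" "Y 1 = (2 * cosh (\<phi> w)) *\<^sub>R e2 w"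
      unfolding X_def Y_def rows by (rule Gx[OF w] Gy[OF w])+
    note p\<phi> = pdx_chain[OF sc(1) \<phi>[OF w]] pdx_chain[OF sc(2) \<phi>[OF w]]
      pdy_chain[OF sc(1) \<phi>[OF w]] pdy_chain[OF sc(2) \<phi>[OF w]]
      differentiable_chain_real[OF sc(1) \<phi>[OF w]] differentiable_chain_real[OF sc(2) \<phi>[OF w]]
    have cong: "pdx (pdx G) w = pdx (\<lambda>w. (2 * sinh (\<phi> w)) *\<^sub>R e1 w) w"
      "pdy (pdx G) w = pdy (\<lambda>w. (2 * sinh (\<phi> w)) *\<^sub>R e1 w) w"
      "pdx (pdy G) w = pdx (\<lambda>w. (2 * cosh (\<phi> w)) *\<^sub>R e2 w) w"
      "pdy (pdy G) w = pdy (\<lambda>w. (2 * cosh (\<phi> w)) *\<^sub>R e2 w) w"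
      by (rule pdx_cong[OF U w Gx] pdy_cong[OF U w Gx] pdx_cong[OF U w Gy] pdy_cong[OF U w Gy], assumption)+
    have xx: "pdx (pdx G) w = (2 * sinh (\<phi> w)) *\<^sub>R X 2 + (2 * cosh (\<phi> w) * pdx \<phi> w) *\<^sub>R e1 w"
      unfolding X_def rows cong pdx_bilinear[OF bl p\<phi>(5) d123(2)[OF w]] p\<phi>(1) by (rule refl)
    have xy: "pdy (pdx G) w = (2 * sinh (\<phi> w)) *\<^sub>R Y 2 + (2 * cosh (\<phi> w) * pdy \<phi> w) *\<^sub>R e1 w"
      unfolding Y_def rows cong pdy_bilinear[OF bl p\<phi>(5) d123(2)[OF w]] p\<phi>(3) by (rule refl)
    have yx: "pdx (pdy G) w = (2 * cosh (\<phi> w)) *\<^sub>R X 3 + (2 * sinh (\<phi> w) * pdx \<phi> w) *\<^sub>R e2 w"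
      unfolding X_def rows cong pdx_bilinear[OF bl p\<phi>(6) d123(3)[OF w]] p\<phi>(2) by (rule refl)
    have yy: "pdy (pdy G) w = (2 * cosh (\<phi> w)) *\<^sub>R Y 3 + (2 * sinh (\<phi> w) * pdy \<phi> w) *\<^sub>R e2 w"
      unfolding Y_def rows cong pdy_bilinear[OF bl p\<phi>(6) d123(3)[OF w]] p\<phi>(4) by (rule refl)
    note d = data'[OF w]
    have on: "e1 w \<bullet> e1 w = 1" "e1 w \<bullet> e2 w = 0" "e1 w \<bullet> n w = 0" "e2 w \<bullet> e2 w = 1" "e2 w \<bullet> n w = 0"
      "e2 w \<bullet> e1 w = 0" "G w \<bullet> n w = 0" "G w \<bullet> G w = 1" "e1 w \<bullet> G w = 0" "e2 w \<bullet> G w = 0" "n w \<bullet> n w = 1"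
      using in_rows[of 2 2] in_rows[of 2 3] in_rows[of 2 4] in_rows[of 3 3] in_rows[of 3 4] in_rows[of 3 2]
        in_rows[of 1 4] in_rows[of 1 1] in_rows[of 2 1] in_rows[of 3 1] in_rows[of 4 4] by (simp_all add: rw)
    have zX: "X i \<bullet> \<Phi> w $ i = 0" and zY: "Y i \<bullet> \<Phi> w $ i = 0" for i
      using skX[of i i] skY[of i i] by simp_all
    \<comment> \<open>The mixed derivative of \<open>G\<close> computed in both orders. Since
      \<open>Y 2\<close> is orthogonal to \<open>e1\<close> and \<open>X 3\<close> to
      \<open>e2\<close>, pairing with \<open>e1\<close> and with \<open>e2\<close> isolates the two
      unknown tangential entries.\<close>
    have sym: "(2 * cosh (\<phi> w)) *\<^sub>R X 3 + (2 * sinh (\<phi> w) * pdx \<phi> w) *\<^sub>R e2 w =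
        (2 * sinh (\<phi> w)) *\<^sub>R Y 2 + (2 * cosh (\<phi> w) * pdy \<phi> w) *\<^sub>R e1 w"
      using d unfolding xy yx by blast
    have x32: "X 3 \<bullet> e1 w = pdy \<phi> w"
      using arg_cong[OF sym, of "\<lambda>y. y \<bullet> e1 w"] C(2)[OF w] zY[of 2] by (simp add: inner_add_left on rw)
    have y23: "Y 2 \<bullet> e2 w = pdx \<phi> w"
      using arg_cong[OF sym, of "\<lambda>y. y \<bullet> e2 w"] S(2)[OF w] zX[of 3] by (simp add: inner_add_left on rw)
    \<comment> \<open>The Laplacian of \<open>G\<close> is a multiple of \<open>G\<close>, so the
      second fundamental form is trace-free and is determined by \<mu>.\<close>
    have nn: "(pdx (pdx G) w + pdy (pdy G) w) \<bullet> n w = 0" "(pdx (pdx G) w - pdy (pdy G) w) \<bullet> n w = 4 * Re (\<mu> w)"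
      "pdx (pdy G) w \<bullet> n w = - 2 * Im (\<mu> w)" "pdy (pdx G) w \<bullet> n w = - 2 * Im (\<mu> w)"
      using d on by auto
    then have nn': "pdx (pdx G) w \<bullet> n w = 2 * Re (\<mu> w)" "pdy (pdy G) w \<bullet> n w = - 2 * Re (\<mu> w)"
      unfolding inner_add_left inner_diff_left by linarith+
    have X24: "X 2 \<bullet> n w = Re (\<mu> w) * inverse (sinh (\<phi> w))"
      and Y24: "Y 2 \<bullet> n w = - Im (\<mu> w) * inverse (sinh (\<phi> w))"
      and X34: "X 3 \<bullet> n w = - Im (\<mu> w) * inverse (cosh (\<phi> w))"
        and Y34: "Y 3 \<bullet> n w = - Re (\<mu> w) * inverse (cosh (\<phi> w))"
      using nn' nn(3,4) S(2)[OF w] C(2)[OF w] unfolding xx xy yx yy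
      by (simp_all add: inner_add_left on field_simps)
    have entX: "\<forall>i j. X i \<bullet> \<Phi> w $ j = conn_x \<phi> \<mu> w $ i $ j"
      unfolding forall_4 conn_x_def skew_def
      using zX[of 1] zX[of 2] zX[of 3] zX[of 4] skX[of 2 1] skX[of 3 1] skX[of 4 1] skX[of 3 2] skX[of 4 2] skX[of 4 3]
        skX[of 1 2] skX[of 1 3] skX[of 1 4] skX[of 2 3] skX[of 2 4] skX[of 3 4] x32 X24 X34
      by (simp add: rw XY1 on)
    have entY: "\<forall>i j. Y i \<bullet> \<Phi> w $ j = conn_y \<phi> \<mu> w $ i $ j"
      unfolding forall_4 conn_y_def skew_def
      using zY[of 1] zY[of 2] zY[of 3] zY[of 4] skY[of 2 1] skY[of 3 1] skY[of 4 1] skY[of 3 2] skY[of 4 2] skY[of 4 3]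
        skY[of 1 2] skY[of 1 3] skY[of 1 4] skY[of 2 3] skY[of 2 4] skY[of 3 4] y23 Y24 Y34
      by (simp add: rw XY1 on)
    have X: "X i = (conn_x \<phi> \<mu> w ** \<Phi> w) $ i" for i
      by (subst orthonormal_expansion_4[OF o[OF w], of "X i"]) (simp add: entX row_matrix_mult_4)
    have Y: "Y i = (conn_y \<phi> \<mu> w ** \<Phi> w) $ i" for i
      by (subst orthonormal_expansion_4[OF o[OF w], of "Y i"]) (simp add: entY row_matrix_mult_4)
    show ?thesis
    proof (rule has_derivative_vec_componentwise)
      fix i
      show "((\<lambda>v. \<Phi> v $ i) has_derivative (\<lambda>k. (one_form (conn_x \<phi> \<mu>) (conn_y \<phi> \<mu>) w k ** \<Phi> w) $ i)) (at w)"
        by (rule has_derivative_eq_rhs[OF has_derivative_pdx_pdy[OF d\<Phi>[OF w]]])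
          (simp add: X_def[symmetric] Y_def[symmetric] X Y one_form_def
            bounded_bilinear.add_left[OF bounded_bilinear_matrix_mult]
            bounded_bilinear.scaleR_left[OF bounded_bilinear_matrix_mult])
    qed
  qed
  then have "moving_frame \<phi> \<mu> U \<Phi>" using o det by (simp add: moving_frame_def)
  then show ?thesis using that[of \<Phi>] by (simp add: \<Phi>_def)
qed

section \<open>Maps into the sphere in coordinates\<close>

lemma
  assumes A: "A differentiable (at w)" and B: "B differentiable (at w)"
  shows pdx_Complex: "pdx (\<lambda>w. Complex (A w) (B w)) w = Complex (pdx A w) (pdx B w)"
    and pdy_Complex: "pdy (\<lambda>w. Complex (A w) (B w)) w = Complex (pdy A w) (pdy B w)"
proof -
  have l: "bounded_linear complex_of_real" "bounded_linear (\<lambda>x. \<i> * complex_of_real x)"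
    by (rule bounded_linear_of_real bounded_linear_compose[OF bounded_linear_mult_right bounded_linear_of_real])+
  note d = differentiable_linear[OF l(1) A] differentiable_linear[OF l(2) B]
  show "pdx (\<lambda>w. Complex (A w) (B w)) w = Complex (pdx A w) (pdx B w)"
    "pdy (\<lambda>w. Complex (A w) (B w)) w = Complex (pdy A w) (pdy B w)"
    unfolding Complex_eq pdx_add[OF d] pdy_add[OF d] pdx_linear[OF l(1) A] pdx_linear[OF l(2) B]
      pdy_linear[OF l(1) A] pdy_linear[OF l(2) B] by (rule refl)+
qed

lemma
  assumes "open (z ` S)" "p \<in> S" and F: "\<forall>w\<in>z ` S. coord_rep S z F w = Complex (A w) (B w)"
    and A: "A differentiable (at (z p))" and B: "B differentiable (at (z p))"
  shows d_z_Complex: "d_z S z F p =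
      Complex ((pdx A (z p) + pdy B (z p)) / 2) ((pdx B (z p) - pdy A (z p)) / 2)"
    and d_zbar_Complex: "d_zbar S z F p =
      Complex ((pdx A (z p) - pdy B (z p)) / 2) ((pdx B (z p) + pdy A (z p)) / 2)"
proof -
  have "z p \<in> z ` S" using assms(2) by blast
  note c = pdx_cong[OF assms(1) this bspec[OF F]] pdy_cong[OF assms(1) this bspec[OF F]]
  have "Dx S z F p = Complex (pdx A (z p)) (pdx B (z p))" "Dy S z F p = Complex (pdy A (z p)) (pdy B (z p))"
    unfolding Dx_def Dy_def by (simp_all only: c pdx_Complex[OF A B] pdy_Complex[OF A B])
  then show "d_z S z F p = Complex ((pdx A (z p) + pdy B (z p)) / 2) ((pdx B (z p) - pdy A (z p)) / 2)"
    "d_zbar S z F p = Complex ((pdx A (z p) - pdy B (z p)) / 2) ((pdx B (z p) + pdy A (z p)) / 2)"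
    by (simp_all add: d_z_def d_zbar_def complex_eq_iff)
qed

text \<open>Real and imaginary parts are kept as real vectors, so that the complex-bilinear product
  turns into real inner products and an equation between complex vectors into two real ones.\<close>

definition Complex_vec :: "real ^ 'n \<Rightarrow> real ^ 'n \<Rightarrow> complex ^ 'n::finite" where
  "Complex_vec a b = (\<chi> i. Complex (a $ i) (b $ i))"

lemma cvec_eq_Complex_vec: "cvec a = Complex_vec a 0"
  by (simp add: cvec_def Complex_vec_def vec_eq_iff complex_eq_iff)

lemma Complex_vec_eq_iff: "Complex_vec a b = Complex_vec c d \<longleftrightarrow> a = c \<and> b = d"
  by (auto simp: Complex_vec_def vec_eq_iff)

lemma scalar_product_Complex_vec:
  "scalar_product (Complex_vec a b) (Complex_vec c d) = Complex (a \<bullet> c - b \<bullet> d) (a \<bullet> d + b \<bullet> c)"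
  by (simp add: scalar_product_def Complex_vec_def complex_eq_iff inner_vec_def sum_subtractf sum.distrib)

lemma
  assumes U: "open (z ` S)" and p: "p \<in> S"
    and F: "\<forall>w\<in>z ` S. coord_rep S z F w = Complex_vec (A w) (B w)"
    and A: "A differentiable (at (z p))" and B: "B differentiable (at (z p))"
  shows d_z_vec_Complex_vec: "d_z_vec S z F p =
      Complex_vec ((1/2) *\<^sub>R (pdx A (z p) + pdy B (z p))) ((1/2) *\<^sub>R (pdx B (z p) - pdy A (z p)))"
    and d_zbar_vec_Complex_vec: "d_zbar_vec S z F p =
      Complex_vec ((1/2) *\<^sub>R (pdx A (z p) - pdy B (z p))) ((1/2) *\<^sub>R (pdx B (z p) + pdy A (z p)))"
proof -
  have c: "\<forall>w\<in>z ` S. coord_rep S z (\<lambda>q. F q $ i) w = Complex (A w $ i) (B w $ i)" for i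
    using F by (simp add: coord_rep_def Complex_vec_def)
  note n = bounded_linear_vec_nth
  show "d_z_vec S z F p =
      Complex_vec ((1/2) *\<^sub>R (pdx A (z p) + pdy B (z p))) ((1/2) *\<^sub>R (pdx B (z p) - pdy A (z p)))"
    "d_zbar_vec S z F p =
      Complex_vec ((1/2) *\<^sub>R (pdx A (z p) - pdy B (z p))) ((1/2) *\<^sub>R (pdx B (z p) + pdy A (z p)))"
    unfolding d_z_vec_def d_zbar_vec_def d_z_Complex[OF U p c differentiable_linear[OF n A] differentiable_linear[OF n B]]
      d_zbar_Complex[OF U p c differentiable_linear[OF n A] differentiable_linear[OF n B]]
      pdx_linear[OF n A] pdx_linear[OF n B] pdy_linear[OF n A] pdy_linear[OF n B]
    by (simp_all add: Complex_vec_def)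
qed

lemma coord_rep_at:
  assumes "complex_coordinate S z" "p \<in> S"
  shows "coord_rep S z F (z p) = F p"
  using assms by (simp add: complex_coordinate_def coord_rep_def homeomorphism_def)

text \<open>The two mixed derivatives are kept apart: their difference is the imaginary part of the
  expression for \<open>delbar\<close>, and their equality will be a consequence of
  harmonicity.\<close>

lemma
  assumes z: "complex_coordinate S z" and f: "smooth S z f" and p: "p \<in> S"
  defines "G \<equiv> coord_rep S z f"
  shows del_eq: "del S z f p = Complex_vec ((1/2) *\<^sub>R pdx G (z p)) ((-1/2) *\<^sub>R pdy G (z p))"
    and delbar_eq: "delbar S z f p = Complex_vec ((1/2) *\<^sub>R pdx G (z p)) ((1/2) *\<^sub>R pdy G (z p))"
    and d_z_del_eq: "d_z_vec S z (del S z f) p =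
      Complex_vec ((1/4) *\<^sub>R (pdx (pdx G) (z p) - pdy (pdy G) (z p)))
        ((-1/4) *\<^sub>R (pdx (pdy G) (z p) + pdy (pdx G) (z p)))"
    and d_z_delbar_eq: "d_z_vec S z (delbar S z f) p =
      Complex_vec ((1/4) *\<^sub>R (pdx (pdx G) (z p) + pdy (pdy G) (z p)))
        ((1/4) *\<^sub>R (pdx (pdy G) (z p) - pdy (pdx G) (z p)))"
proof -
  have U: "open (z ` S)" using z by (simp add: complex_coordinate_def)
  have dG: "G differentiable (at w)" "pdx G differentiable (at w)" "pdy G differentiable (at w)" if "w \<in> z ` S" for w
    using f[unfolded smooth_def, rule_format, of "Suc (Suc 0)"] that by (auto simp: G_def)
  have c0: "\<forall>w\<in>z ` S. coord_rep S z (\<lambda>q. cvec (f q)) w = Complex_vec (G w) 0"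
    by (simp add: coord_rep_def G_def cvec_eq_Complex_vec)
  have zero: "(\<lambda>w. 0 :: real ^ 4) differentiable (at w)" "pdx (\<lambda>w. 0 :: real ^ 4) w = 0" "pdy (\<lambda>w. 0 :: real ^ 4) w = 0" for w
    using pdx_eqI[OF has_derivative_const] pdy_eqI[OF has_derivative_const] by auto
  have del: "del S z f q = Complex_vec ((1/2) *\<^sub>R pdx G (z q)) ((-1/2) *\<^sub>R pdy G (z q))"
    and delbar: "delbar S z f q = Complex_vec ((1/2) *\<^sub>R pdx G (z q)) ((1/2) *\<^sub>R pdy G (z q))" if q: "q \<in> S" for q
  proof -
    have "z q \<in> z ` S" using q by blast
    note d = dG(1)[OF this]
    show "del S z f q = Complex_vec ((1/2) *\<^sub>R pdx G (z q)) ((-1/2) *\<^sub>R pdy G (z q))"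
      "delbar S z f q = Complex_vec ((1/2) *\<^sub>R pdx G (z q)) ((1/2) *\<^sub>R pdy G (z q))"
      unfolding del_def delbar_def d_z_vec_Complex_vec[OF U q c0 d zero(1)] d_zbar_vec_Complex_vec[OF U q c0 d zero(1)] zero
      by simp_all
  qed
  show "del S z f p = Complex_vec ((1/2) *\<^sub>R pdx G (z p)) ((-1/2) *\<^sub>R pdy G (z p))"
    "delbar S z f p = Complex_vec ((1/2) *\<^sub>R pdx G (z p)) ((1/2) *\<^sub>R pdy G (z p))"
    by (rule del[OF p] delbar[OF p])+
  have c1: "\<forall>w\<in>z ` S. coord_rep S z (del S z f) w = Complex_vec ((1/2) *\<^sub>R pdx G w) ((-1/2) *\<^sub>R pdy G w)"
    and c2: "\<forall>w\<in>z ` S. coord_rep S z (delbar S z f) w = Complex_vec ((1/2) *\<^sub>R pdx G w) ((1/2) *\<^sub>R pdy G w)"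
    by (auto simp only: coord_rep_at[OF z] del delbar)
  have "z p \<in> z ` S" using p by blast
  note d = dG[OF this]
  note l = bounded_linear_scaleR_right
  note dl = differentiable_linear[OF l d(2)] differentiable_linear[OF l d(3)]
  note e = d_z_vec_Complex_vec[OF U p c1 dl] d_z_vec_Complex_vec[OF U p c2 dl]
    pdx_linear[OF l d(2)] pdx_linear[OF l d(3)] pdy_linear[OF l d(2)] pdy_linear[OF l d(3)]
  show "d_z_vec S z (del S z f) p =
      Complex_vec ((1/4) *\<^sub>R (pdx (pdx G) (z p) - pdy (pdy G) (z p)))
        ((-1/4) *\<^sub>R (pdx (pdy G) (z p) + pdy (pdx G) (z p)))"
    "d_z_vec S z (delbar S z f) p =
      Complex_vec ((1/4) *\<^sub>R (pdx (pdx G) (z p) + pdy (pdy G) (z p)))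
        ((1/4) *\<^sub>R (pdx (pdy G) (z p) - pdy (pdx G) (z p)))"
    unfolding e by (simp_all add: Complex_vec_eq_iff algebra_simps)
qed

text \<open>Real and imaginary parts are compared point by point. One direction serves existence,
  the other uniqueness. The coordinate formulas require differentiability, so the non-smooth case is
  split off; there both sides fail.\<close>

lemma harmonic_map_with_data_iff:
  assumes z: "complex_coordinate S z"
  shows "harmonic_map_with_data S z \<phi> \<mu> f N \<longleftrightarrow>
    surface_data (z ` S) (coord_rep S z \<phi>) (coord_rep S z \<mu>) (coord_rep S z f) (coord_rep S z N)"
proof (cases "smooth S z f")
  case True
  define G where "G = coord_rep S z f"
  define L where "L p \<longleftrightarrow> (f p \<in> sphere 0 1 \<and> d_z_vec S z (delbar S z f) p =
        - scalar_product (del S z f p) (delbar S z f p) *s cvec (f p) \<and>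
      scalar_product (del S z f p) (del S z f p) \<noteq> 0 \<and>
      norm (N p) = 1 \<and> N p \<bullet> f p = 0 \<and> N p \<bullet> Dx S z f p = 0 \<and> N p \<bullet> Dy S z f p = 0 \<and>
        det (vector [f p, Dx S z f p, Dy S z f p, N p] :: real ^ 4 ^ 4) > 0 \<and>
      (\<forall>i j. scalar_product (frame S z f N p $ i) (frame S z f N p $ j) = gram_matrix (\<phi> p) $ i $ j) \<and>
      scalar_product (d_z_vec S z (del S z f) p) (cvec (N p)) = \<mu> p)" for p
  define R where "R p w \<longleftrightarrow> (G w \<bullet> G w = 1 \<and> G w \<bullet> pdx G w = 0 \<and> G w \<bullet> pdy G w = 0 \<and>
     pdx G w \<bullet> pdx G w = (2 * sinh (\<phi> p))\<^sup>2 \<and> pdy G w \<bullet> pdy G w = (2 * cosh (\<phi> p))\<^sup>2 \<and>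
     pdx G w \<bullet> pdy G w = 0 \<and>
     N p \<bullet> N p = 1 \<and> N p \<bullet> G w = 0 \<and> N p \<bullet> pdx G w = 0 \<and> N p \<bullet> pdy G w = 0 \<and>
     det (vector [G w, pdx G w, pdy G w, N p] :: real ^ 4 ^ 4) > 0 \<and>
     pdx (pdx G) w + pdy (pdy G) w = (- 4 * cosh (2 * \<phi> p)) *\<^sub>R G w \<and> pdx (pdy G) w = pdy (pdx G) w \<and>
     (pdx (pdx G) w - pdy (pdy G) w) \<bullet> N p = 4 * Re (\<mu> p) \<and> pdx (pdy G) w \<bullet> N p = - 2 * Im (\<mu> p))" for p w
  have pt: "L p \<longleftrightarrow> R p w"
    if p: "p \<in> S" and w: "w = z p" for p w
  proof -
    define a b c n where "a = f p" and "b = pdx G w" and "c = pdy G w" and "n = N p"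
    define h k l m where "h = pdx (pdx G) w" and "k = pdy (pdy G) w" and "l = pdx (pdy G) w" and "m = pdy (pdx G) w"
    have G: "G w = a" by (simp add: G_def w a_def coord_rep_at[OF z p])
    have D: "Dx S z f p = b" "Dy S z f p = c" by (simp_all add: Dx_def Dy_def b_def c_def G_def w)
    have e1: "del S z f p = Complex_vec ((1/2) *\<^sub>R b) ((-1/2) *\<^sub>R c)"
      and e2: "delbar S z f p = Complex_vec ((1/2) *\<^sub>R b) ((1/2) *\<^sub>R c)"
      and e3: "d_z_vec S z (del S z f) p = Complex_vec ((1/4) *\<^sub>R (h - k)) ((-1/4) *\<^sub>R (l + m))"
      and e4: "d_z_vec S z (delbar S z f) p = Complex_vec ((1/4) *\<^sub>R (h + k)) ((1/4) *\<^sub>R (l - m))"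
      unfolding b_def c_def h_def k_def l_def m_def G_def w
      by (rule del_eq[OF z True p] delbar_eq[OF z True p] d_z_del_eq[OF z True p] d_z_delbar_eq[OF z True p])+
    define C where "C = cosh (2 * \<phi> p)"
    have C: "(2 * sinh (\<phi> p))\<^sup>2 = 2 * C - 2" "(2 * cosh (\<phi> p))\<^sup>2 = 2 * C + 2"
      by (simp_all add: C_def cosh_double power_mult_distrib cosh_square_eq)
    have sp: "scalar_product (del S z f p) (delbar S z f p) = of_real ((b \<bullet> b + c \<bullet> c) / 4)"
      unfolding e1 e2 scalar_product_Complex_vec by (simp add: complex_eq_iff inner_commute)
    \<comment> \<open>The Gram entries of \<open>del\<close> and \<open>delbar\<close> give b
      \<bullet> b - c \<bullet> c = -4 and b \<bullet> b + c \<bullet> c = 4 C from the real parts,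
      and the orthogonality of \<open>b\<close> and \<open>c\<close> from the imaginary
      part.\<close>
    have gram: "(\<forall>i j. scalar_product (frame S z f N p $ i) (frame S z f N p $ j) = gram_matrix (\<phi> p) $ i $ j) \<longleftrightarrow>
        a \<bullet> a = 1 \<and> a \<bullet> b = 0 \<and> a \<bullet> c = 0 \<and> b \<bullet> b = 2 * C - 2 \<and> c \<bullet> c = 2 * C + 2 \<and> b \<bullet> c = 0 \<and>
        n \<bullet> n = 1 \<and> n \<bullet> a = 0 \<and> n \<bullet> b = 0 \<and> n \<bullet> c = 0"
      unfolding forall_4 frame_def gram_matrix_def e1 e2 cvec_eq_Complex_vec a_def[symmetric] n_def[symmetric] C_def[symmetric]
      by (simp add: scalar_product_Complex_vec complex_eq_iff) (auto simp: inner_commute field_simps)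
    have harm: "d_z_vec S z (delbar S z f) p = - scalar_product (del S z f p) (delbar S z f p) *s cvec (f p) \<longleftrightarrow>
        h + k = (- (b \<bullet> b + c \<bullet> c)) *\<^sub>R a \<and> l = m"
    proof -
      have q1: "- scalar_product (del S z f p) (delbar S z f p) *s cvec (f p) = Complex_vec ((- (b \<bullet> b + c \<bullet> c) / 4) *\<^sub>R a) 0"
        unfolding sp by (simp add: cvec_def Complex_vec_def vec_eq_iff complex_eq_iff a_def field_simps)
      have q2: "(1/4) *\<^sub>R (h + k) = (- (b \<bullet> b + c \<bullet> c) / 4) *\<^sub>R a \<longleftrightarrow> h + k = (- (b \<bullet> b + c \<bullet> c)) *\<^sub>R a"
      proof -
        have "(- (b \<bullet> b + c \<bullet> c) / 4) *\<^sub>R a = (1/4) *\<^sub>R ((- (b \<bullet> b + c \<bullet> c)) *\<^sub>R a)" by simp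
        then show ?thesis by (simp only: scaleR_cancel_left) simp
      qed
      show ?thesis unfolding q1 e4 Complex_vec_eq_iff q2 by simp
    qed
    \<comment> \<open>The imaginary part of \<mu> sees the sum of the mixed derivatives; with their
      equality from \<open>harm\<close>, each has normal component -2 Im \<mu>.\<close>
    have mu: "scalar_product (d_z_vec S z (del S z f) p) (cvec (N p)) = \<mu> p \<longleftrightarrow>
        (h - k) \<bullet> n = 4 * Re (\<mu> p) \<and> l \<bullet> n + m \<bullet> n = - 4 * Im (\<mu> p)"
    proof -
      have q1: "scalar_product (d_z_vec S z (del S z f) p) (cvec (N p)) =
          Complex ((h - k) \<bullet> n / 4) (- (l \<bullet> n + m \<bullet> n) / 4)"
        unfolding e3 cvec_eq_Complex_vec scalar_product_Complex_vec n_def[symmetric]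
        by (simp add: inner_add_left add_divide_distrib)
      have q2: "Complex (x / 4) (- y / 4) = v \<longleftrightarrow> x = 4 * Re v \<and> y = - 4 * Im v" for x y v
        by (auto simp: complex_eq_iff)
      show ?thesis unfolding q1 q2 by (rule refl)
    qed
    have nc: "scalar_product (del S z f p) (del S z f p) = Complex ((b \<bullet> b - c \<bullet> c) / 4) (- (b \<bullet> c) / 2)"
      unfolding e1 scalar_product_Complex_vec by (simp add: inner_commute field_simps)
    show ?thesis
      unfolding L_def R_def harm mu gram nc D
        unfolding a_def[symmetric] n_def[symmetric] G b_def[symmetric] c_def[symmetric]
        h_def[symmetric] k_def[symmetric] l_def[symmetric] m_def[symmetric] C C_def[symmetric]
      by (auto simp: norm_eq_1 complex_eq_iff inner_commute)
  qed
  have "harmonic_map_with_data S z \<phi> \<mu> f N \<longleftrightarrow> (\<forall>p\<in>S. L p)"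
    unfolding harmonic_map_with_data_def harmonic_S3_def non_conformal_def unit_normal_def L_def image_subset_iff
    using True by blast
  also have "\<dots> \<longleftrightarrow> (\<forall>p\<in>S. R p (z p))" using pt by blast
  also have "\<dots> \<longleftrightarrow> surface_data (z ` S) (coord_rep S z \<phi>) (coord_rep S z \<mu>) G (coord_rep S z N)"
  proof -
    have "(\<forall>k. Ck_on k (z ` S) G) = True" using True by (simp add: smooth_def G_def)
    moreover have "\<phi> p = coord_rep S z \<phi> (z p)" "\<mu> p = coord_rep S z \<mu> (z p)" "N p = coord_rep S z N (z p)" if "p \<in> S" for p
      using that by (simp_all only: coord_rep_at[OF z])
    ultimately show ?thesis
      unfolding surface_data_def R_def ball_simps by (simp only: simp_thms cong: ball_cong)
  qed
  finally show ?thesis by (simp only: G_def)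
next
  case False
  then show ?thesis
    unfolding harmonic_map_with_data_def harmonic_S3_def surface_data_def smooth_def by blast
qed

text \<open>Needed on the way back to the surface: the coordinate representation of a map G(z(p))
  agrees with \<open>G\<close> on the coordinate domain, while outside it \<open>inv_into\<close> is
  arbitrary.\<close>

lemma surface_data_cong:
  assumes U: "open U" and G: "\<And>w. w \<in> U \<Longrightarrow> G w = G' w"
    and n: "\<And>w. w \<in> U \<Longrightarrow> n w = n' w"
    and data: "surface_data U \<phi> \<mu> G n"
  shows "surface_data U \<phi> \<mu> G' n'"
proof -
  have 1: "pdx G w = pdx G' w" "pdy G w = pdy G' w" if "w \<in> U" for w
    by (rule pdx_cong[OF U that G] pdy_cong[OF U that G], assumption)+
  have 2: "pdx (pdx G) w = pdx (pdx G') w" "pdy (pdx G) w = pdy (pdx G') w"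
    "pdx (pdy G) w = pdx (pdy G') w" "pdy (pdy G) w = pdy (pdy G') w" if "w \<in> U" for w
    by (rule pdx_cong[OF U that 1(1)] pdy_cong[OF U that 1(1)] pdx_cong[OF U that 1(2)] pdy_cong[OF U that 1(2)], assumption)+
  have "Ck_on k U G \<longleftrightarrow> Ck_on k U G'" for k
    by (rule Ck_on_cong[OF U G])
  then have "surface_data U \<phi> \<mu> G n \<longleftrightarrow> surface_data U \<phi> \<mu> G' n'"
    unfolding surface_data_def by (simp only: 1 2 G n cong: ball_cong)
  with data show ?thesis by simp
qed

theorem proposition4p1:
  fixes S :: "'a::topological_space set" and z :: "'a \<Rightarrow> complex"
    and \<phi> :: "'a \<Rightarrow> real" and \<mu> :: "'a \<Rightarrow> complex"
  assumes "simply_connected S" and "complex_coordinate S z"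
    and "smooth S z \<phi>" and "\<And>p. p \<in> S \<Longrightarrow> \<phi> p > 0"
    and "smooth S z \<mu>"
    and "\<And>p. p \<in> S \<Longrightarrow>
      2 * d_z S z (d_zbar S z (\<lambda>q. complex_of_real (\<phi> q))) p =
      complex_of_real (- sinh (2 * \<phi> p) + (cmod (\<mu> p))\<^sup>2 * csch (2 * \<phi> p))"
    and "\<And>p. p \<in> S \<Longrightarrow>
      d_zbar S z \<mu> p =
      - 2 * cnj (\<mu> p) * d_z S z (\<lambda>q. complex_of_real (\<phi> q)) p * complex_of_real (csch (2 * \<phi> p))"
  shows "(\<exists>f N. harmonic_map_with_data S z \<phi> \<mu> f N) \<and>
    (\<forall>f N g N\<^sub>g. harmonic_map_with_data S z \<phi> \<mu> f N \<and> harmonic_map_with_data S z \<phi> \<mu> g N\<^sub>g \<longrightarrow>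
      (\<exists>R :: real ^ 4 ^ 4. orthogonal_matrix R \<and> (\<forall>p\<in>S. g p = R *v f p)))"
proof -
  note z = assms(2)
  define U where "U = z ` S"
  define P where "P = coord_rep S z \<phi>"
  define M where "M = coord_rep S z \<mu>"
  have U: "open U" using z by (simp add: complex_coordinate_def U_def)
  have "S homeomorphic U"
    using z unfolding complex_coordinate_def homeomorphic_def U_def by blast
  then have scU: "simply_connected U" using homeomorphic_simply_connected assms(1) by blast
  then have conU: "connected U" by (rule simply_connected_imp_connected)
  have CkP: "Ck_on k U P" and CkM: "Ck_on k U M" for k
    using assms(3,5) by (simp_all add: smooth_def U_def P_def M_def)
  have P: "P (z p) = \<phi> p" and M: "M (z p) = \<mu> p" if "p \<in> S" for p
    unfolding P_def M_def by (rule coord_rep_at[OF z that])+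
  have pos: "P w > 0" if "w \<in> U" for w
    using that assms(4) by (auto simp: U_def P)
  have dP: "P differentiable (at w)" "pdx P differentiable (at w)" "pdy P differentiable (at w)"
    if "w \<in> U" for w
    using CkP[of "Suc (Suc 0)"] that by auto
  have zero: "(\<lambda>w. 0 :: real) differentiable (at w)" "pdx (\<lambda>w. 0 :: real) w = 0" "pdy (\<lambda>w. 0 :: real) w = 0" for w
    using pdx_eqI[OF has_derivative_const] pdy_eqI[OF has_derivative_const] by auto
  have c0: "\<forall>w\<in>z ` S. coord_rep S z (\<lambda>q. complex_of_real (\<phi> q)) w = Complex (P w) 0"
    by (simp add: coord_rep_def P_def complex_eq_iff)
  have dbar: "d_zbar S z (\<lambda>q. complex_of_real (\<phi> q)) p = Complex (pdx P (z p) / 2) (pdy P (z p) / 2)"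
    and d: "d_z S z (\<lambda>q. complex_of_real (\<phi> q)) p = Complex (pdx P (z p) / 2) (- pdy P (z p) / 2)" if p: "p \<in> S" for p
  proof -
    have "z p \<in> U" using p by (simp add: U_def)
    note e = U[unfolded U_def] p c0 dP(1)[OF this] zero(1)
    show "d_zbar S z (\<lambda>q. complex_of_real (\<phi> q)) p = Complex (pdx P (z p) / 2) (pdy P (z p) / 2)"
      "d_z S z (\<lambda>q. complex_of_real (\<phi> q)) p = Complex (pdx P (z p) / 2) (- pdy P (z p) / 2)"
      unfolding d_zbar_Complex[OF e] d_z_Complex[OF e] zero by simp_all
  qed
  \<comment> \<open>Twice \<open>d_z\<close> after \<open>d_zbar\<close> has real part half the
    Laplacian of \<phi>, whence the factor 2 on the right.\<close>
  have gauss: "pdx (pdx P) w + pdy (pdy P) w = 2 * (- sinh (2 * P w) + (cmod (M w))\<^sup>2 / sinh (2 * P w))"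
    if w: "w \<in> U" for w
  proof -
    obtain p where p: "p \<in> S" "w = z p" using w by (auto simp: U_def)
    note l = bounded_linear_divide[of "2 :: real"]
    have c: "\<forall>w\<in>z ` S. coord_rep S z (d_zbar S z (\<lambda>q. complex_of_real (\<phi> q))) w = Complex (pdx P w / 2) (pdy P w / 2)"
      by (auto simp only: coord_rep_at[OF z] dbar)
    have "Re (d_z S z (d_zbar S z (\<lambda>q. complex_of_real (\<phi> q))) p) = (pdx (pdx P) w / 2 + pdy (pdy P) w / 2) / 2"
      unfolding d_z_Complex[OF U[unfolded U_def] p(1) c differentiable_linear[OF l dP(2)[OF w[unfolded p(2)]]]
          differentiable_linear[OF l dP(3)[OF w[unfolded p(2)]]]]
      by (simp add: pdx_linear[OF l dP(2)[OF w]] pdy_linear[OF l dP(3)[OF w]] p(2)[symmetric])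
    moreover have "2 * Re (d_z S z (d_zbar S z (\<lambda>q. complex_of_real (\<phi> q))) p) =
        - sinh (2 * \<phi> p) + (cmod (\<mu> p))\<^sup>2 * csch (2 * \<phi> p)"
      using arg_cong[OF assms(6)[OF p(1)], of Re] by simp
    ultimately show ?thesis
      unfolding p(2) P[OF p(1)] M[OF p(1)] by (simp add: csch_def)
  qed
  have codazzi: "pdx M w + \<i> * pdy M w =
      - 4 * cnj (M w) * ((of_real (pdx P w) - \<i> * of_real (pdy P w)) / 2) / of_real (sinh (2 * P w))"
    if w: "w \<in> U" for w
  proof -
    obtain p where p: "p \<in> S" "w = z p" using w by (auto simp: U_def)
    have "(pdx M w + \<i> * pdy M w) / 2 = d_zbar S z \<mu> p"
      by (simp add: d_zbar_def Dx_def Dy_def M_def p(2))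
    also have "\<dots> = - 2 * cnj (M w) * ((of_real (pdx P w) - \<i> * of_real (pdy P w)) / 2) * of_real (csch (2 * P w))"
    proof -
      have "d_z S z (\<lambda>q. complex_of_real (\<phi> q)) p = (of_real (pdx P w) - \<i> * of_real (pdy P w)) / 2"
        unfolding d[OF p(1)] p(2) by (simp add: complex_eq_iff)
      then show ?thesis using assms(7)[OF p(1)] by (simp only: p(2) P[OF p(1)] M[OF p(1)])
    qed
    finally have "pdx M w + \<i> * pdy M w =
        2 * (- 2 * cnj (M w) * ((of_real (pdx P w) - \<i> * of_real (pdy P w)) / 2) * of_real (csch (2 * P w)))"
      by (simp only: divide_eq_eq mult.commute) simp
    then show ?thesis by (simp add: csch_def)
  qed
  have iff: "harmonic_map_with_data S z \<phi> \<mu> f N \<longleftrightarrow> surface_data U P M (coord_rep S z f) (coord_rep S z N)" for f N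
    unfolding U_def P_def M_def by (rule harmonic_map_with_data_iff[OF z])
  have "\<exists>G n. surface_data U P M G n"
  \<comment> \<open>A frame is constructed from its value at a base point. On the empty surface
    every map has the data.\<close>
  proof (cases "U = {}")
    case True
    then have "surface_data U P M (\<lambda>w. 0) (\<lambda>w. 0)" by (simp add: surface_data_def Ck_on_const)
    then show ?thesis by blast
  next
    case False
    obtain \<Phi> where \<Phi>: "moving_frame P M U \<Phi>" "\<forall>k. Ck_on k U \<Phi>"
      by (rule moving_frame_exists[OF U scU False CkP pos CkM gauss codazzi])
    from surface_data_of_frame[OF U dP(1) pos \<Phi>(1) \<Phi>(2)[rule_format]] show ?thesis by blast
  qed
  then obtain G n where Gn: "surface_data U P M G n" by blast
  have "coord_rep S z (\<lambda>p. F (z p)) w = F w" if "w \<in> U" for F :: "complex \<Rightarrow> real ^ 4" and w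
    using that by (auto simp: coord_rep_def U_def f_inv_into_f)
  then have "harmonic_map_with_data S z \<phi> \<mu> (\<lambda>p. G (z p)) (\<lambda>p. n (z p))"
    unfolding iff by (intro surface_data_cong[OF U _ _ Gn]) simp_all
  moreover have "\<exists>R :: real ^ 4 ^ 4. orthogonal_matrix R \<and> (\<forall>p\<in>S. g p = R *v f p)"
    if fg: "harmonic_map_with_data S z \<phi> \<mu> f N" "harmonic_map_with_data S z \<phi> \<mu> g N'" for f N g N'
  proof (cases "S = {}")
    case True
    then show ?thesis using orthogonal_matrix_id by blast
  next
    case False
    then obtain w0 where w0: "w0 \<in> U" by (auto simp: U_def)
    obtain \<Phi> where \<Phi>: "moving_frame P M U \<Phi>" "\<forall>w. \<Phi> w $ 1 = coord_rep S z f w"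
      by (rule moving_frame_of_surface_data[OF U dP(1) pos fg(1)[unfolded iff]])
    obtain \<Psi> where \<Psi>: "moving_frame P M U \<Psi>" "\<forall>w. \<Psi> w $ 1 = coord_rep S z g w"
      by (rule moving_frame_of_surface_data[OF U dP(1) pos fg(2)[unfolded iff]])
    obtain R :: "real ^ 4 ^ 4" where R: "orthogonal_matrix R" "\<forall>w\<in>U. \<Psi> w $ 1 = R *v (\<Phi> w $ 1)"
      by (rule moving_frames_congruent[OF U conU w0 \<Phi>(1) \<Psi>(1)])
    have "g p = R *v f p" if p: "p \<in> S" for p
      using bspec[OF R(2), of "z p"] p \<Phi>(2) \<Psi>(2) by (simp add: coord_rep_at[OF z p] U_def)
    then show ?thesis using R(1) by blast
  qed
  ultimately show ?thesis by blast
qed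

end
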